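(* Let $X$ be a Lévy process with Lévy triplet $(0,0,\nu)$. Assume that $\nu$ is of the form $\nu(ds)=|s|^{-\alpha-1}q(|s|)\,ds$, where $0<\alpha<2$ and $q$ is a completely monotone function on $\mathbb{R}_+$, not identically zero, such that $$\int_1^\infty s^{j-\alpha-1}q(s)\,ds<\infty\qquad\text{for all integers }j\ge1.$$ Assume also that the measure $F$ for which $q(s)=\int_0^\infty e^{-\lambda s}F(d\lambda)$ satisfies $$\int_0^\infty\lambda^jF(d\lambda)<\infty\qquad\text{for all integers }j\ge0.$$ Then the function $\gamma$ defined by $\psi_t(u):=\mathbb{E}e^{\mathrm{i}uX_t}=e^{t\gamma(u)}$ satisfies the following two conditions: (1) for each integer $i\ge1$ there exist $c_i<\infty$ and $u_{0,i}>0$ such that $|\gamma^{(i)}(u)|\le c_i|u|^{\alpha-i}$ for all $|u|>u_{0,i}$; (2) there exist $u_0>0$ and $0<c_0<\infty$ such that $|\psi_1(u)|\le e^{-c_0|u|^\alpha}$ for all $u>u_0$.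
   Context: A Lévy process has triplet $(\sigma^2,b,\nu)$ if $X_t=bt+\sigma W_t+\int_0^t\int_{|x|\le1}x\,(\mu-\bar\mu)(dx,ds)+\int_0^t\int_{|x|>1}x\,\mu(dx,ds)$, where $W$ is a standard Brownian motion and $\mu$ is an independent Poisson random measure on $\mathbb{R}_+\times(\mathbb{R}\setminus\{0\})$ with mean measure $\bar\mu(dx,dt)=\nu(dx)\,dt$. Here $\sigma=b=0$. The function $\gamma$ is the continuous characteristic exponent with $\gamma(0)=0$; $\mathrm{i}$ (upright) is the imaginary unit. *)

theory Defs
  imports "HOL-Probability.Probability"
begin

section \<open>Levy processes, Poisson random measures and the Levy-Ito decomposition\<close>

definition (in prob_space) indep_increments :: "(real \<Rightarrow> 'a \<Rightarrow> real) \<Rightarrow> bool" where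
  "indep_increments X \<longleftrightarrow>
     (\<forall>(n::nat) \<tau>::nat \<Rightarrow> real. 0 \<le> \<tau> 0 \<longrightarrow> mono \<tau> \<longrightarrow>
        indep_vars (\<lambda>_. borel) (\<lambda>i \<omega>. X (\<tau> (Suc i)) \<omega> - X (\<tau> i) \<omega>) {..<n})"

text \<open>Processes are indexed by the type \<^typ>\<open>real\<close>; only the times \<open>t \<ge> 0\<close> matter.\<close>

definition (in prob_space) levy_process :: "(real \<Rightarrow> 'a \<Rightarrow> real) \<Rightarrow> bool" where
  "levy_process X \<longleftrightarrow>
     (\<forall>t\<ge>0. random_variable borel (X t)) \<and>
     (AE \<omega> in M. X 0 \<omega> = 0) \<and>
     indep_increments X \<and>
     (\<forall>s\<ge>0. \<forall>t\<ge>0. distr M borel (\<lambda>\<omega>. X (s + t) \<omega> - X s \<omega>) = distr M borel (X t)) \<and>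
     (AE \<omega> in M. \<forall>t\<ge>0. continuous (at_right t) (\<lambda>s. X s \<omega>) \<and>
                         (t > 0 \<longrightarrow> (\<exists>l. ((\<lambda>s. X s \<omega>) \<longlongrightarrow> l) (at_left t))))"

definition (in prob_space) standard_brownian_motion :: "(real \<Rightarrow> 'a \<Rightarrow> real) \<Rightarrow> bool" where
  "standard_brownian_motion W \<longleftrightarrow>
     (\<forall>t\<ge>0. random_variable borel (W t)) \<and>
     (AE \<omega> in M. W 0 \<omega> = 0) \<and>
     indep_increments W \<and>
     (\<forall>s t. 0 \<le> s \<longrightarrow> s < t \<longrightarrow>
        distributed M lborel (\<lambda>\<omega>. W t \<omega> - W s \<omega>) (normal_density 0 (sqrt (t - s)))) \<and>
     (AE \<omega> in M. continuous_on {0..} (\<lambda>t. W t \<omega>))"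

text \<open>The Poisson law is written out because \<^const>\<open>poisson_pmf\<close> is unspecified at rate 0.\<close>

definition (in prob_space) poisson_random_measure :: "'e measure \<Rightarrow> ('a \<Rightarrow> 'e measure) \<Rightarrow> bool" where
  "poisson_random_measure m N \<longleftrightarrow>
     (\<forall>\<omega>\<in>space M. sets (N \<omega>) = sets m) \<and>
     (\<forall>A\<in>sets m. random_variable borel (\<lambda>\<omega>. emeasure (N \<omega>) A)) \<and>
     (\<forall>A\<in>sets m. emeasure m A < \<infinity> \<longrightarrow>
        (\<forall>k::nat. prob {\<omega>\<in>space M. emeasure (N \<omega>) A = of_nat k} =
                   exp (- measure m A) * measure m A ^ k / fact k)) \<and>
     (\<forall>A\<in>sets m. emeasure m A = \<infinity> \<longrightarrow> (AE \<omega> in M. emeasure (N \<omega>) A = \<infinity>)) \<and>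
     (\<forall>(n::nat) A. disjoint_family_on A {..<n} \<longrightarrow> A ` {..<n} \<subseteq> sets m \<longrightarrow>
        indep_vars (\<lambda>_. borel) (\<lambda>i \<omega>. emeasure (N \<omega>) (A i)) {..<n})"

definition (in prob_space) indep_process_random_measure ::
    "(real \<Rightarrow> 'a \<Rightarrow> real) \<Rightarrow> 'e measure \<Rightarrow> ('a \<Rightarrow> 'e measure) \<Rightarrow> bool" where
  "indep_process_random_measure W m N \<longleftrightarrow>
     indep_set
       (sigma_sets (space M) {W t -` B \<inter> space M | t B. 0 \<le> t \<and> B \<in> sets borel})
       (sigma_sets (space M)
          {(\<lambda>\<omega>. emeasure (N \<omega>) A) -` B \<inter> space M | A B. A \<in> sets m \<and> B \<in> sets borel})"

text \<open>Measures on the punctured line are represented as Borel measures on the line without an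
  atom at 0.\<close>

definition levy_measure :: "real measure \<Rightarrow> bool" where
  "levy_measure \<nu> \<longleftrightarrow>
     sets \<nu> = sets borel \<and> emeasure \<nu> {0} = 0 \<and> (\<integral>\<^sup>+x. ennreal (min 1 (x\<^sup>2)) \<partial>\<nu>) < \<infinity>"

text \<open>Points of \<open>\<real>\<^sub>+ \<times> \<real>\<close> are pairs (time, jump size).\<close>

definition jump_mean_measure :: "real measure \<Rightarrow> (real \<times> real) measure" where
  "jump_mean_measure \<nu> = restrict_space lborel {0..} \<Otimes>\<^sub>M \<nu>"

definition jump_integral :: "(real \<times> real) measure \<Rightarrow> real \<Rightarrow> real set \<Rightarrow> real" where
  "jump_integral R t B = (LINT p:{0..t} \<times> B|R. snd p)"

text \<open>\<open>Y = \<integral>\<^sub>0\<^sup>t \<integral>\<^bsub>\<bar>x\<bar>\<le>1\<^esub> x (\<mu> - m)(dx,ds)\<close>: in general \<open>x\<close> is not integrable near 0 for either \<open>\<mu>\<close> or \<open>m\<close>,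
  so the compensated integral is the mean-square limit of the integrals over \<open>\<epsilon> < \<bar>x\<bar> \<le> 1\<close>.\<close>

definition (in prob_space) compensated_small_jumps ::
    "(real \<times> real) measure \<Rightarrow> ('a \<Rightarrow> (real \<times> real) measure) \<Rightarrow> real \<Rightarrow> ('a \<Rightarrow> real) \<Rightarrow> bool" where
  "compensated_small_jumps m N t Y \<longleftrightarrow>
     random_variable borel Y \<and>
     ((\<lambda>\<epsilon>. \<integral>\<^sup>+\<omega>. ennreal ((Y \<omega> - (jump_integral (N \<omega>) t {x. \<epsilon> < \<bar>x\<bar> \<and> \<bar>x\<bar> \<le> 1}
                                 - jump_integral m t {x. \<epsilon> < \<bar>x\<bar> \<and> \<bar>x\<bar> \<le> 1}))\<^sup>2) \<partial>M)
        \<longlongrightarrow> 0) (at_right 0)"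

text \<open>The first parameter \<open>v\<close> is the variance \<open>\<sigma>\<^sup>2\<close>. A Brownian motion is demanded only if \<open>v > 0\<close>:
  otherwise it does not contribute, and the probability space need not carry one.\<close>

definition (in prob_space) has_levy_triplet ::
    "(real \<Rightarrow> 'a \<Rightarrow> real) \<Rightarrow> real \<Rightarrow> real \<Rightarrow> real measure \<Rightarrow> bool" where
  "has_levy_triplet X v b \<nu> \<longleftrightarrow>
     0 \<le> v \<and> levy_measure \<nu> \<and>
     (\<exists>W N Y.
        (v > 0 \<longrightarrow> standard_brownian_motion W \<and>
                   indep_process_random_measure W (jump_mean_measure \<nu>) N) \<and>
        poisson_random_measure (jump_mean_measure \<nu>) N \<and>
        (\<forall>t\<ge>0. compensated_small_jumps (jump_mean_measure \<nu>) N t (Y t)) \<and>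
        (\<forall>t\<ge>0. AE \<omega> in M.
           X t \<omega> = b * t + sqrt v * W t \<omega> + Y t \<omega> + jump_integral (N \<omega>) t {x. \<bar>x\<bar> > 1}))"

definition (in prob_space) characteristic_exponent ::
    "(real \<Rightarrow> 'a \<Rightarrow> real) \<Rightarrow> (real \<Rightarrow> complex) \<Rightarrow> bool" where
  "characteristic_exponent X \<gamma> \<longleftrightarrow>
     continuous_on UNIV \<gamma> \<and> \<gamma> 0 = 0 \<and>
     (\<forall>t\<ge>0. \<forall>u. char (distr M borel (X t)) u = exp (of_real t * \<gamma> u))"


section \<open>Completely monotone functions and higher derivatives\<close>

text \<open>Only the values of \<open>q\<close> on \<open>(0,\<infinity>)\<close> matter.\<close>

definition completely_monotone :: "(real \<Rightarrow> real) \<Rightarrow> bool" where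
  "completely_monotone q \<longleftrightarrow>
     (\<forall>n. \<forall>s>0. (deriv ^^ n) q differentiable (at s) \<and> 0 \<le> (- 1) ^ n * (deriv ^^ n) q s)"

definition nth_vector_derivative ::
    "nat \<Rightarrow> (real \<Rightarrow> 'a) \<Rightarrow> real \<Rightarrow> 'a::real_normed_vector" where
  "nth_vector_derivative n f = ((\<lambda>g u. vector_derivative g (at u)) ^^ n) f"

definition times_differentiable :: "nat \<Rightarrow> (real \<Rightarrow> 'a::real_normed_vector) \<Rightarrow> bool" where
  "times_differentiable n f \<longleftrightarrow> (\<forall>k<n. \<forall>u. nth_vector_derivative k f differentiable (at u))"

end

theory Submission
  imports Defs
begin

text \<open>
  Since \<open>\<nu>\<close> is symmetric, \<open>\<gamma>(u) = \<integral> (cos (u s) - 1) \<nu>(ds)\<close>, and smoothness follows by differentiating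
  under the integral, all moments of \<open>\<nu>\<close> of order at least 2 being finite. For the bounds, take
  \<open>u > 0\<close> (\<open>\<gamma>\<close> is even), insert \<open>q(s) = \<integral> e\<^bsup>-\<lambda>s\<^esup> F(d\<lambda>)\<close> and substitute \<open>v = u s\<close>: this gives
  \<open>-\<gamma>(u) = u\<^sup>\<alpha> \<integral> e\<^bsup>-x/u\<^esup> \<rho>(dx)\<close> for a finite nonzero measure \<open>\<rho>\<close> on the half-line, the image of
  \<open>(1 - cos v) \<bar>v\<bar>\<^bsup>-\<alpha>-1\<^esup> dv \<otimes> F(d\<lambda>)\<close> under \<open>\<lambda> \<bar>v\<bar>\<close>. The \<open>i\<close>-th derivative of \<open>u\<^sup>\<alpha> e\<^bsup>-x/u\<^esup>\<close> is
  \<open>u\<^bsup>\<alpha>-i\<^esup>\<close> times a bounded function of \<open>x/u\<close>, which yields (1) without any integration by parts, and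
  \<open>e\<^bsup>-x/u\<^esup> \<ge> e\<^bsup>-x\<^esup>\<close> for \<open>u \<ge> 1\<close> yields (2).
\<close>

section \<open>Integrals against Poisson random measures\<close>

lemma poisson_weights_sums:
  fixes c :: real and z :: complex
  shows "(\<lambda>k::nat. complex_of_real (exp (- c) * c ^ k / fact k) * z ^ k) sums exp (of_real c * (z - 1))"
proof -
  have "(\<lambda>k. (of_real c * z) ^ k /\<^sub>R fact k) sums exp (of_real c * z)"
    by (rule exp_converges)
  from sums_mult[OF this, of "exp (- of_real c)"] show ?thesis
    by (simp add: scaleR_conv_of_real power_mult_distrib field_simps exp_minus exp_diff
        flip: exp_of_real)
qed

lemma poisson_weights_sums_1: "(\<lambda>k. exp (- c) * c ^ k / fact k) sums (1 :: real)"
  using sums_mult[OF exp_converges[of c], of "exp (- c)"]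
  by (simp add: field_simps exp_minus scaleR_conv_of_real)

context prob_space
begin

lemma poisson_random_measureD:
  assumes "poisson_random_measure m N" "A \<in> sets m"
  shows "random_variable borel (\<lambda>\<omega>. emeasure (N \<omega>) A)"
    and "emeasure m A < \<infinity> \<Longrightarrow>
      prob {\<omega>\<in>space M. emeasure (N \<omega>) A = of_nat k} = exp (- measure m A) * measure m A ^ k / fact k"
    and "emeasure m A = \<infinity> \<Longrightarrow> AE \<omega> in M. emeasure (N \<omega>) A = \<infinity>"
  using assms unfolding poisson_random_measure_def by auto

lemma poisson_random_measure_sets:
  "poisson_random_measure m N \<Longrightarrow> \<omega> \<in> space M \<Longrightarrow> sets (N \<omega>) = sets m"
  unfolding poisson_random_measure_def by auto

text \<open>The probabilities of the events that the count equals k sum to 1, so almost surely the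
  count is a natural number. This moves all computations with one count to a discrete law on
  \<open>nat\<close>.\<close>

lemma poisson_count_eq_nat:
  assumes N: "poisson_random_measure m N" and A: "A \<in> sets m" "emeasure m A < \<infinity>"
  obtains K :: "'a \<Rightarrow> nat" where "K \<in> measurable M (count_space UNIV)"
    "AE \<omega> in M. emeasure (N \<omega>) A = of_nat (K \<omega>)"
    "distr M (count_space UNIV) K =
      density (count_space UNIV) (\<lambda>k. ennreal (exp (- measure m A) * measure m A ^ k / fact k))"
proof
  define c where "c = measure m A"
  have c: "0 \<le> c" by (simp add: c_def)
  note [measurable] = poisson_random_measureD(1)[OF N A(1)]
  \<comment> \<open>A measurable natural-valued version of the count: it returns k on the event
    \<open>E k\<close>, and its values off the union of these events lie on a null set.\<close>
  define K where "K = (\<lambda>\<omega>. nat \<lfloor>enn2real (emeasure (N \<omega>) A)\<rfloor>)"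
  show K[measurable]: "K \<in> measurable M (count_space UNIV)"
    unfolding K_def by measurable
  define E where "E k = {\<omega>\<in>space M. emeasure (N \<omega>) A = of_nat k}" for k
  have E: "prob (E k) = exp (- c) * c ^ k / fact k" for k
    unfolding E_def c_def by (rule poisson_random_measureD(2)[OF N A])
  have [measurable]: "E k \<in> sets M" for k
    unfolding E_def by measurable
  have "(\<lambda>k. prob (E k)) sums prob (\<Union>k. E k)"
    by (rule finite_measure_UNION) (auto simp: disjoint_family_on_def E_def)
  moreover have "(\<lambda>k. prob (E k)) sums 1"
    unfolding E by (rule poisson_weights_sums_1)
  ultimately have "prob (\<Union>k. E k) = 1"
    using sums_unique2 by blast
  then have "AE \<omega> in M. \<omega> \<in> (\<Union>k. E k)"
    by (subst (asm) prob_eq_1) auto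
  then show ae: "AE \<omega> in M. emeasure (N \<omega>) A = of_nat (K \<omega>)"
    by eventually_elim (auto simp: E_def K_def ennreal_of_nat_eq_real_of_nat)
  show "distr M (count_space UNIV) K =
      density (count_space UNIV) (\<lambda>k. ennreal (exp (- measure m A) * measure m A ^ k / fact k))"
  proof (rule measure_eqI_countable[of _ UNIV])
    fix k :: nat
    have "emeasure (distr M (count_space UNIV) K) {k} = emeasure M (K -` {k} \<inter> space M)"
      by (subst emeasure_distr) auto
    also have "\<dots> = emeasure M (E k)"
    proof (rule emeasure_eq_AE)
      show "AE \<omega> in M. \<omega> \<in> K -` {k} \<inter> space M \<longleftrightarrow> \<omega> \<in> E k"
        using ae AE_space by eventually_elim (auto simp: E_def)
    qed auto
    also have "\<dots> = ennreal (exp (- c) * c ^ k / fact k)"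
      by (simp add: emeasure_eq_measure E)
    finally show "emeasure (distr M (count_space UNIV) K) {k} = emeasure (density (count_space UNIV)
        (\<lambda>k. ennreal (exp (- measure m A) * measure m A ^ k / fact k))) {k}"
      by (simp add: emeasure_density c_def nn_integral_count_space_indicator nn_integral_count_space_finite)
  qed auto
qed

lemma poisson_count_expectation:
  assumes N: "poisson_random_measure m N" and A: "A \<in> sets m"
  shows "(\<integral>\<^sup>+\<omega>. emeasure (N \<omega>) A \<partial>M) = emeasure m A"
proof (cases "emeasure m A = \<infinity>")
  case True
  then show ?thesis
    using nn_integral_cong_AE[OF poisson_random_measureD(3)[OF N A True]] by (simp add: emeasure_space_1)
next
  case False
  then have fin: "emeasure m A < \<infinity>" by (simp add: less_top)
  define c where "c = measure m A"
  have c: "0 \<le> c" by (simp add: c_def)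
  obtain K where K[measurable]: "K \<in> measurable M (count_space UNIV)"
    and ae: "AE \<omega> in M. emeasure (N \<omega>) A = of_nat (K \<omega>)"
    and D: "distr M (count_space UNIV) K =
      density (count_space UNIV) (\<lambda>k. ennreal (exp (- c) * c ^ k / fact k))"
    unfolding c_def by (rule poisson_count_eq_nat[OF N A fin])
  have sums: "(\<lambda>k. exp (- c) * c ^ k / fact k * real k) sums c"
  proof -
    \<comment> \<open>The factor \<open>Suc k\<close> cancels against \<open>fact (Suc k)\<close>
      and leaves c times the Poisson weights. The term of index 0, restored afterwards by
      \<open>sums_Suc\<close>, vanishes.\<close>
    have "(\<lambda>k. exp (- c) * c ^ Suc k / fact (Suc k) * real (Suc k)) sums c"
      using sums_mult[OF poisson_weights_sums_1[of c], of c] by (simp add: mult_ac)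
    from sums_Suc[OF this] show ?thesis by simp
  qed
  have "(\<integral>\<^sup>+\<omega>. emeasure (N \<omega>) A \<partial>M) = (\<integral>\<^sup>+\<omega>. of_nat (K \<omega>) \<partial>M)"
    by (rule nn_integral_cong_AE[OF ae])
  also have "\<dots> = (\<integral>\<^sup>+k. of_nat k \<partial>distr M (count_space UNIV) K)"
    by (subst nn_integral_distr) auto
  also have "\<dots> = (\<integral>\<^sup>+k. ennreal (exp (- c) * c ^ k / fact k * real k) \<partial>count_space UNIV)"
    unfolding D using c by (subst nn_integral_density)
      (auto intro!: nn_integral_cong simp: ennreal_of_nat_eq_real_of_nat simp flip: ennreal_mult'')
  also have "\<dots> = ennreal c"
    unfolding nn_integral_count_space_nat
    using sums c by (subst suminf_ennreal2) (auto simp: sums_iff)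
  finally show ?thesis
    using fin by (simp add: c_def emeasure_eq_ennreal_measure)
qed

lemma poisson_count_char:
  assumes N: "poisson_random_measure m N" and A: "A \<in> sets m" "emeasure m A < \<infinity>"
  shows "char (distr M borel (\<lambda>\<omega>. y * measure (N \<omega>) A)) u
    = exp (of_real (measure m A) * (iexp (u * y) - 1))"
proof -
  define c where "c = measure m A"
  have c: "0 \<le> c" by (simp add: c_def)
  obtain K where K[measurable]: "K \<in> measurable M (count_space UNIV)"
    and ae: "AE \<omega> in M. emeasure (N \<omega>) A = of_nat (K \<omega>)"
    and D: "distr M (count_space UNIV) K =
      density (count_space UNIV) (\<lambda>k. ennreal (exp (- c) * c ^ k / fact k))"
    unfolding c_def by (rule poisson_count_eq_nat[OF N A])
  note [measurable] = poisson_random_measureD(1)[OF N A(1)]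
  have [measurable]: "(\<lambda>\<omega>. measure (N \<omega>) A) \<in> borel_measurable M"
    unfolding measure_def by measurable
  let ?g = "\<lambda>k. complex_of_real (exp (- c) * c ^ k / fact k) * iexp (u * y) ^ k"
  have pw: "iexp (u * y) ^ k = iexp (u * (y * real k))" for k
    by (simp add: mult_ac flip: exp_of_nat_mult)
  have nrm: "norm (?g k) = exp (- c) * c ^ k / fact k" for k
    using c by (simp add: norm_mult norm_power norm_divide)
  have "summable (\<lambda>k. norm (?g k))"
    unfolding nrm using poisson_weights_sums_1[of c] by (simp only: sums_iff)
  then have int: "integrable (count_space UNIV) ?g"
    by (simp add: integrable_count_space_nat_iff)
  have "char (distr M borel (\<lambda>\<omega>. y * measure (N \<omega>) A)) u
      = (\<integral>\<omega>. iexp (u * (y * measure (N \<omega>) A)) \<partial>M)"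
    unfolding char_def by (subst integral_distr) auto
  also have "\<dots> = (\<integral>\<omega>. iexp (u * y) ^ K \<omega> \<partial>M)"
  proof (rule integral_cong_AE)
    show "AE \<omega> in M. iexp (u * (y * measure (N \<omega>) A)) = iexp (u * y) ^ K \<omega>"
      unfolding pw using ae by eventually_elim (simp add: measure_def)
  qed auto
  also have "\<dots> = (\<integral>k. iexp (u * y) ^ k \<partial>distr M (count_space UNIV) K)"
    by (subst integral_distr) auto
  also have "\<dots> = (\<integral>k. ?g k \<partial>count_space UNIV)"
    unfolding D using c by (subst integral_density) (auto simp: scaleR_conv_of_real)
  also have "\<dots> = exp (of_real c * (iexp (u * y) - 1))"
    using sums_integral_count_space_nat[OF int] poisson_weights_sums[of c "iexp (u * y)"]
    by (rule sums_unique2)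
  finally show ?thesis by (simp add: c_def)
qed

text \<open>Campbell's formula, by induction on nonnegative measurable functions. The base case is
  the mean of a count, and the limit case uses monotone convergence under both
  \<open>N \<omega>\<close> and \<open>M\<close>. Measurability in \<omega> is part of the induction
  because linearity of the outer integral relies on it.\<close>

lemma poisson_nn_integral:
  assumes N: "poisson_random_measure m N" and g: "g \<in> borel_measurable m"
  shows "(\<lambda>\<omega>. \<integral>\<^sup>+p. g p \<partial>N \<omega>) \<in> borel_measurable M
    \<and> (\<integral>\<^sup>+\<omega>. (\<integral>\<^sup>+p. g p \<partial>N \<omega>) \<partial>M) = (\<integral>\<^sup>+p. g p \<partial>m)"
  using g
proof induction
  case (cong f g)
  have "(\<integral>\<^sup>+p. f p \<partial>N \<omega>) = (\<integral>\<^sup>+p. g p \<partial>N \<omega>)" if "\<omega> \<in> space M" for \<omega>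
    using cong sets_eq_imp_space_eq[OF poisson_random_measure_sets[OF N that]]
    by (intro nn_integral_cong) auto
  moreover have "(\<integral>\<^sup>+p. f p \<partial>m) = (\<integral>\<^sup>+p. g p \<partial>m)"
    using cong by (intro nn_integral_cong) auto
  ultimately show ?case
    using cong(4) by (simp cong: measurable_cong nn_integral_cong)
next
  case (set A)
  have "(\<integral>\<^sup>+p. indicator A p \<partial>N \<omega>) = emeasure (N \<omega>) A" if "\<omega> \<in> space M" for \<omega>
    using set poisson_random_measure_sets[OF N that] by simp
  with set show ?case
    using poisson_random_measureD(1)[OF N set] poisson_count_expectation[OF N set]
    by (simp cong: measurable_cong nn_integral_cong)
next
  case (mult f c)
  have "(\<integral>\<^sup>+p. c * f p \<partial>N \<omega>) = c * (\<integral>\<^sup>+p. f p \<partial>N \<omega>)" if "\<omega> \<in> space M" for \<omega>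
    using mult poisson_random_measure_sets[OF N that]
    by (intro nn_integral_cmult) (simp cong: measurable_cong_sets)
  with mult show ?case
    by (auto simp: nn_integral_cmult cong: measurable_cong nn_integral_cong)
next
  case (add f g)
  have "(\<integral>\<^sup>+p. g p + f p \<partial>N \<omega>) = (\<integral>\<^sup>+p. g p \<partial>N \<omega>) + (\<integral>\<^sup>+p. f p \<partial>N \<omega>)" if "\<omega> \<in> space M" for \<omega>
    using add poisson_random_measure_sets[OF N that]
    by (intro nn_integral_add) (simp_all cong: measurable_cong_sets)
  with add show ?case
    by (auto simp: nn_integral_add cong: measurable_cong nn_integral_cong)
next
  case (seq U)
  have eq: "(\<integral>\<^sup>+p. (SUP i. U i p) \<partial>N \<omega>) = (SUP i. \<integral>\<^sup>+p. U i p \<partial>N \<omega>)" if "\<omega> \<in> space M" for \<omega>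
    using seq poisson_random_measure_sets[OF N that]
    by (intro nn_integral_monotone_convergence_SUP) (simp_all cong: measurable_cong_sets)
  have "incseq (\<lambda>i \<omega>. \<integral>\<^sup>+p. U i p \<partial>N \<omega>)"
    using seq by (auto simp: incseq_def le_fun_def intro!: nn_integral_mono)
  then have "(\<integral>\<^sup>+\<omega>. (SUP i. \<integral>\<^sup>+p. U i p \<partial>N \<omega>) \<partial>M) = (SUP i. \<integral>\<^sup>+\<omega>. (\<integral>\<^sup>+p. U i p \<partial>N \<omega>) \<partial>M)"
    using seq by (intro nn_integral_monotone_convergence_SUP) auto
  moreover have "(\<lambda>\<omega>. SUP i. \<integral>\<^sup>+p. U i p \<partial>N \<omega>) \<in> borel_measurable M"
    using seq by (intro borel_measurable_SUP) auto
  ultimately show ?case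
    using seq by (simp add: eq nn_integral_monotone_convergence_SUP image_comp cong: measurable_cong nn_integral_cong)
qed

text \<open>By Campbell's formula the integral of the norm has finite mean, hence is finite almost
  surely.\<close>

lemma poisson_integrable_AE:
  fixes f :: "'e \<Rightarrow> real"
  assumes N: "poisson_random_measure m N" and f: "integrable m f"
  shows "AE \<omega> in M. integrable (N \<omega>) f"
proof -
  have [measurable]: "f \<in> borel_measurable m" using f by auto
  have g: "(\<lambda>p. ennreal (norm (f p))) \<in> borel_measurable m" by measurable
  have "(\<integral>\<^sup>+\<omega>. (\<integral>\<^sup>+p. ennreal (norm (f p)) \<partial>N \<omega>) \<partial>M) \<noteq> \<infinity>"
    using poisson_nn_integral[OF N g] f by (auto simp: integrable_iff_bounded)
  then have "AE \<omega> in M. (\<integral>\<^sup>+p. ennreal (norm (f p)) \<partial>N \<omega>) \<noteq> \<infinity>"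
    using poisson_nn_integral[OF N g] by (intro nn_integral_noteq_infinite) auto
  then show ?thesis
    using AE_space
  proof eventually_elim
    case (elim \<omega>)
    then show ?case
      using poisson_random_measure_sets[OF N elim(2)]
      by (auto simp: integrable_iff_bounded less_top cong: measurable_cong_sets)
  qed
qed

text \<open>The integral is a linear combination of the counts of disjoint level sets. These counts
  are independent Poisson variables, so the characteristic functions multiply and the exponents add
  up to an integral. T is a measurable version of the integral, equal to it wherever the counts are
  finite.\<close>

lemma poisson_simple_integral:
  fixes s :: "'e \<Rightarrow> real"
  assumes N: "poisson_random_measure m N" and s: "simple_function m s"
    and fin: "emeasure m {p\<in>space m. s p \<noteq> 0} < \<infinity>"
  obtains T where "random_variable borel T" "AE \<omega> in M. T \<omega> = (\<integral>p. s p \<partial>N \<omega>)"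
    "\<And>u. char (distr M borel T) u = exp (\<integral>p. iexp (u * s p) - 1 \<partial>m)"
proof
  \<comment> \<open>The value 0 is dropped: its level set may have infinite mass, and it contributes
    nothing.\<close>
  define J where "J = s ` space m - {0}"
  define A where "A y = s -` {y} \<inter> space m" for y
  have J: "finite J" using s by (auto simp: J_def simple_function_def)
  have A[measurable]: "A y \<in> sets m" for y
    using s by (simp add: A_def simple_functionD)
  have finA: "emeasure m (A y) < \<infinity>" if "y \<in> J" for y
    using that s by (intro le_less_trans[OF emeasure_mono fin])
      (auto simp: A_def J_def intro: simple_functionD borel_measurable_simple_function)
  \<comment> \<open>Stated for every g with \<open>g 0 = 0\<close>, so as to serve both for the
    integrand itself and for \<open>iexp (u * s p) - 1\<close>.\<close>
  have expand: "g (s p) = (\<Sum>y\<in>J. indicator (A y) p *\<^sub>R g y)"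
    if "p \<in> space m" "g 0 = 0" for p and g :: "real \<Rightarrow> 'b::real_vector"
  proof -
    have "(\<Sum>y\<in>J. indicator (A y) p *\<^sub>R g y) = (\<Sum>y\<in>J. if y = s p then g y else 0)"
      using that by (intro sum.cong) (auto simp: A_def)
    also have "\<dots> = g (s p)"
      using J that by (auto simp: J_def)
    finally show ?thesis ..
  qed
  note [measurable] = poisson_random_measureD(1)[OF N A]
  define T where "T = (\<lambda>\<omega>. \<Sum>y\<in>J. y * measure (N \<omega>) (A y))"
  have [measurable]: "(\<lambda>\<omega>. measure (N \<omega>) (A y)) \<in> borel_measurable M" for y
    unfolding measure_def by measurable
  show "random_variable borel T"
    unfolding T_def by measurable
  have "AE \<omega> in M. \<forall>y\<in>J. emeasure (N \<omega>) (A y) < \<infinity>"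
  proof (rule AE_finite_allI[OF J])
    fix y assume "y \<in> J"
    from poisson_count_eq_nat[OF N A finA[OF this]] obtain K
      where "AE \<omega> in M. emeasure (N \<omega>) (A y) = of_nat (K \<omega>)" by blast
    then show "AE \<omega> in M. emeasure (N \<omega>) (A y) < \<infinity>"
      by eventually_elim (simp add: of_nat_less_top)
  qed
  then show "AE \<omega> in M. T \<omega> = (\<integral>p. s p \<partial>N \<omega>)"
    using AE_space
  proof eventually_elim
    case (elim \<omega>)
    note S = poisson_random_measure_sets[OF N elim(2)]
    have "(\<integral>p. s p \<partial>N \<omega>) = (\<integral>p. (\<Sum>y\<in>J. indicator (A y) p *\<^sub>R y) \<partial>N \<omega>)"
      using expand[of _ "\<lambda>x. x"] sets_eq_imp_space_eq[OF S]
      by (intro Bochner_Integration.integral_cong) auto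
    also have "\<dots> = (\<Sum>y\<in>J. \<integral>p. indicator (A y) p *\<^sub>R y \<partial>N \<omega>)"
      using elim S by (intro Bochner_Integration.integral_sum) auto
    also have "\<dots> = T \<omega>"
      using S sets_eq_imp_space_eq[OF S] A sets.sets_into_space[OF A]
      by (auto simp: T_def mult.commute Int_absorb2 intro!: sum.cong)
    finally show ?case ..
  qed
  show "char (distr M borel T) u = exp (\<integral>p. iexp (u * s p) - 1 \<partial>m)" for u
  proof -
    \<comment> \<open>Independence is available for families indexed by an initial segment of the
      naturals, so J is enumerated.\<close>
    obtain h where h: "bij_betw h {..<card J} J"
      using ex_bij_betw_nat_finite[OF J] by (auto simp: atLeast0LessThan)
    have T: "T = (\<lambda>\<omega>. \<Sum>i<card J. h i * measure (N \<omega>) (A (h i)))"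
      unfolding T_def using h by (auto intro!: sum.reindex_bij_betw[symmetric])
    have "disjoint_family_on (\<lambda>i. A (h i)) {..<card J}"
      using h by (auto simp: disjoint_family_on_def A_def bij_betw_def inj_on_def)
    then have "indep_vars (\<lambda>_. borel) (\<lambda>i \<omega>. emeasure (N \<omega>) (A (h i))) {..<card J}"
      using N A unfolding poisson_random_measure_def by blast
    then have "indep_vars (\<lambda>_. borel) (\<lambda>i \<omega>. h i * enn2real (emeasure (N \<omega>) (A (h i)))) {..<card J}"
      by (rule indep_vars_compose2) measurable
    then have "char (distr M borel T) u
        = (\<Prod>i<card J. char (distr M borel (\<lambda>\<omega>. h i * measure (N \<omega>) (A (h i)))) u)"
      unfolding T measure_def by (rule char_distr_sum)
    also have "\<dots> = (\<Prod>y\<in>J. char (distr M borel (\<lambda>\<omega>. y * measure (N \<omega>) (A y))) u)"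
      by (rule prod.reindex_bij_betw[OF h])
    also have "\<dots> = (\<Prod>y\<in>J. exp (of_real (measure m (A y)) * (iexp (u * y) - 1)))"
      by (intro prod.cong refl poisson_count_char[OF N] A finA)
    also have "\<dots> = exp (\<Sum>y\<in>J. of_real (measure m (A y)) * (iexp (u * y) - 1))"
      by (rule exp_sum[OF J, symmetric])
    also have "(\<Sum>y\<in>J. of_real (measure m (A y)) * (iexp (u * y) - 1))
        = (\<Sum>y\<in>J. \<integral>p. indicator (A y) p *\<^sub>R (iexp (u * y) - 1) \<partial>m)"
      using A sets.sets_into_space[OF A] by (intro sum.cong) (auto simp: Int_absorb2 scaleR_conv_of_real)
    also have "\<dots> = (\<integral>p. (\<Sum>y\<in>J. indicator (A y) p *\<^sub>R (iexp (u * y) - 1)) \<partial>m)"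
      using finA by (intro Bochner_Integration.integral_sum[symmetric]) auto
    also have "\<dots> = (\<integral>p. iexp (u * s p) - 1 \<partial>m)"
      using expand[of _ "\<lambda>y. iexp (u * y) - 1"]
      by (intro Bochner_Integration.integral_cong) auto
    finally show ?thesis .
  qed
qed

text \<open>Approximation by simple functions dominated by twice the absolute value of f. Dominated
  convergence is applied three times: under \<open>N \<omega>\<close> for the integrals, under
  \<open>M\<close> for the characteristic functions, and under \<open>m\<close> for the
  exponents.\<close>

lemma poisson_integral_char:
  fixes f :: "'e \<Rightarrow> real"
  assumes N: "poisson_random_measure m N" and f: "integrable m f"
    and fin: "emeasure m {p\<in>space m. f p \<noteq> 0} < \<infinity>"
  obtains T where "random_variable borel T" "AE \<omega> in M. T \<omega> = (\<integral>p. f p \<partial>N \<omega>)"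
    "\<And>u. char (distr M borel T) u = exp (\<integral>p. iexp (u * f p) - 1 \<partial>m)"
proof -
  have f_meas[measurable]: "f \<in> borel_measurable m" using f by auto
  obtain S where S: "\<And>i. simple_function m (S i)"
    and lim: "\<And>p. p \<in> space m \<Longrightarrow> (\<lambda>i. S i p) \<longlonglongrightarrow> f p"
    and bound: "\<And>i p. p \<in> space m \<Longrightarrow> \<bar>S i p\<bar> \<le> 2 * \<bar>f p\<bar>"
    using borel_measurable_implies_sequence_metric[OF f_meas, of 0]
    by simp metis
  note [measurable] = borel_measurable_simple_function[OF S]
  have S0: "S i p = 0" if "p \<in> space m" "f p = 0" for i p
    using bound[OF that(1), of i] that by simp
  have finS: "emeasure m {p\<in>space m. S i p \<noteq> 0} < \<infinity>" for i
    using S0 by (intro le_less_trans[OF emeasure_mono fin]) auto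
  have "\<exists>T. random_variable borel T \<and> (AE \<omega> in M. T \<omega> = (\<integral>p. S i p \<partial>N \<omega>)) \<and>
      (\<forall>u. char (distr M borel T) u = exp (\<integral>p. iexp (u * S i p) - 1 \<partial>m))" for i
    by (rule poisson_simple_integral[OF N S[of i] finS[of i]]) blast
  then have "\<exists>T. \<forall>i. random_variable borel (T i) \<and> (AE \<omega> in M. T i \<omega> = (\<integral>p. S i p \<partial>N \<omega>)) \<and>
      (\<forall>u. char (distr M borel (T i)) u = exp (\<integral>p. iexp (u * S i p) - 1 \<partial>m))"
    by (intro choice allI)
  then obtain T where T[measurable]: "\<And>i. random_variable borel (T i)"
    and T_int: "\<And>i. AE \<omega> in M. T i \<omega> = (\<integral>p. S i p \<partial>N \<omega>)"
    and T_char: "\<And>i u. char (distr M borel (T i)) u = exp (\<integral>p. iexp (u * S i p) - 1 \<partial>m)"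
    by blast
  \<comment> \<open>The pointwise \<open>lim\<close> is measurable whether or not the sequence
    converges; almost surely it is the integral of f.\<close>
  define L where "L = (\<lambda>\<omega>. lim (\<lambda>i. T i \<omega>))"
  have L[measurable]: "random_variable borel L"
    unfolding L_def by measurable
  have "AE \<omega> in M. \<forall>i. T i \<omega> = (\<integral>p. S i p \<partial>N \<omega>)"
    using T_int by (simp add: AE_all_countable)
  then have conv: "AE \<omega> in M. (\<lambda>i. T i \<omega>) \<longlonglongrightarrow> (\<integral>p. f p \<partial>N \<omega>)"
    using AE_space poisson_integrable_AE[OF N f]
  proof eventually_elim
    case (elim \<omega>)
    note st = poisson_random_measure_sets[OF N elim(2)]
    note sp = sets_eq_imp_space_eq[OF st]
    have "(\<lambda>i. \<integral>p. S i p \<partial>N \<omega>) \<longlonglongrightarrow> (\<integral>p. f p \<partial>N \<omega>)"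
    proof (rule integral_dominated_convergence[where w = "\<lambda>p. 2 * \<bar>f p\<bar>"])
      show "f \<in> borel_measurable (N \<omega>)" "\<And>i. S i \<in> borel_measurable (N \<omega>)"
        using st by (auto cong: measurable_cong_sets)
    qed (use elim sp lim bound in auto)
    with elim show ?case by simp
  qed
  then have "AE \<omega> in M. L \<omega> = (\<integral>p. f p \<partial>N \<omega>)"
    by eventually_elim (simp add: L_def limI)
  moreover have "char (distr M borel L) u = exp (\<integral>p. iexp (u * f p) - 1 \<partial>m)" for u
  proof -
    have "(\<lambda>i. \<integral>\<omega>. iexp (u * T i \<omega>) \<partial>M) \<longlonglongrightarrow> (\<integral>\<omega>. iexp (u * L \<omega>) \<partial>M)"
    proof (rule integral_dominated_convergence[where w = "\<lambda>_. 1"])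
      show "AE \<omega> in M. (\<lambda>i. iexp (u * T i \<omega>)) \<longlonglongrightarrow> iexp (u * L \<omega>)"
        using conv by eventually_elim (auto simp: L_def limI intro!: tendsto_intros)
    qed auto
    moreover have "(\<lambda>i. \<integral>p. iexp (u * S i p) - 1 \<partial>m) \<longlonglongrightarrow> (\<integral>p. iexp (u * f p) - 1 \<partial>m)"
    \<comment> \<open>The integrand has norm at most 2 and vanishes with f, since each
      \<open>S i\<close> does. The finite mass of the support of f thus makes the dominating
      function integrable.\<close>
    proof (rule integral_dominated_convergence[where w = "\<lambda>p. 2 * indicator {p\<in>space m. f p \<noteq> 0} p"])
      show "integrable m (\<lambda>p. 2 * indicator {p\<in>space m. f p \<noteq> 0} p :: real)"
        using fin by auto
      show "AE p in m. (\<lambda>i. iexp (u * S i p) - 1) \<longlonglongrightarrow> iexp (u * f p) - 1"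
        using lim by (auto intro!: AE_I2 tendsto_intros)
      show "AE p in m. norm (iexp (u * S i p) - 1) \<le> 2 * indicator {p\<in>space m. f p \<noteq> 0} p" for i
      proof (intro AE_I2)
        fix p assume p: "p \<in> space m"
        have "norm (iexp (u * S i p) - 1) \<le> norm (iexp (u * S i p)) + norm (1 :: complex)"
          by (rule norm_triangle_ineq4)
        with S0[OF p] p show "norm (iexp (u * S i p) - 1) \<le> 2 * indicator {p\<in>space m. f p \<noteq> 0} p"
          by (auto simp: indicator_def)
      qed
    qed auto
    then have "(\<lambda>i. exp (\<integral>p. iexp (u * S i p) - 1 \<partial>m)) \<longlonglongrightarrow> exp (\<integral>p. iexp (u * f p) - 1 \<partial>m)"
      by (rule tendsto_exp)
    then have "(\<lambda>i. \<integral>\<omega>. iexp (u * T i \<omega>) \<partial>M) \<longlonglongrightarrow> exp (\<integral>p. iexp (u * f p) - 1 \<partial>m)"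
      unfolding T_char[symmetric] char_def by (subst (asm) integral_distr) auto
    ultimately show ?thesis
      unfolding char_def by (subst integral_distr) (auto intro: LIMSEQ_unique)
  qed
  ultimately show ?thesis
    using that L by blast
qed

end


section \<open>Symmetric pure jump processes\<close>

lemma abs_cos_minus_one_le: "\<bar>cos x - 1\<bar> \<le> x\<^sup>2" for x :: real
proof -
  have "\<bar>cos x - 1\<bar> = 2 * (sin (x / 2))\<^sup>2"
    using cos_double_sin[of "x / 2"] by simp
  also have "(sin (x / 2))\<^sup>2 \<le> (x / 2)\<^sup>2"
    using abs_sin_x_le_abs_x[of "x / 2"] by (simp flip: abs_le_square_iff)
  finally show ?thesis by (simp add: power_divide) (smt (verit) zero_le_power2)
qed

text \<open>Reflection turns the integral into its own negative. For a non-integrable h the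
  computation goes through with the default value 0.\<close>

lemma symmetric_integral_odd:
  fixes h :: "real \<Rightarrow> 'b::{banach, second_countable_topology}"
  assumes sym: "distr \<nu> borel uminus = \<nu>" and h: "h \<in> borel_measurable borel" "\<And>x. h (- x) = - h x"
  shows "(\<integral>x. h x \<partial>\<nu>) = 0"
proof -
  have [measurable_cong]: "sets \<nu> = sets borel"
    using sets_distr[of \<nu> borel uminus] unfolding sym .
  have "(\<integral>x. h x \<partial>\<nu>) = (\<integral>x. h x \<partial>distr \<nu> borel uminus)"
    by (simp add: sym)
  also have "\<dots> = - (\<integral>x. h x \<partial>\<nu>)"
    using h by (subst integral_distr) auto
  finally have "2 *\<^sub>R (\<integral>x. h x \<partial>\<nu>) = 0"
    by (simp add: scaleR_2 eq_neg_iff_add_eq_0)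
  then show ?thesis by simp
qed

text \<open>Fubini on time and jump size: the time factor integrates to the length t of the
  interval.\<close>

lemma jump_mean_measure_integral:
  fixes h :: "real \<Rightarrow> 'b::{banach, second_countable_topology}"
  assumes sf: "sigma_finite_measure \<nu>" and h: "integrable \<nu> h" and t: "0 \<le> t"
  shows "integrable (jump_mean_measure \<nu>) (\<lambda>p. indicator {0..t} (fst p) *\<^sub>R h (snd p))"
    and "(\<integral>p. indicator {0..t} (fst p) *\<^sub>R h (snd p) \<partial>jump_mean_measure \<nu>) = t *\<^sub>R (\<integral>x. h x \<partial>\<nu>)"
proof -
  let ?Q = "restrict_space lborel {0::real..}"
  interpret Q: sigma_finite_measure ?Q
    by (rule sigma_finite_measure_restrict_space) (auto intro: lborel.sigma_finite_measure_axioms)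
  interpret nu: sigma_finite_measure \<nu> by fact
  interpret pair_sigma_finite ?Q \<nu> ..
  have [measurable]: "h \<in> borel_measurable \<nu>" using h by auto
  have [measurable]: "{0..t} \<in> sets ?Q"
    by (auto simp: sets_restrict_space image_iff intro!: exI[of _ "{0..t}"])
  have mQ: "emeasure ?Q {0..t} = ennreal t"
    using t by (subst emeasure_restrict_space) auto
  have ind: "integrable ?Q (indicator {0..t} :: real \<Rightarrow> real)"
    using mQ by (intro integrable_real_indicator) auto
  show int: "integrable (jump_mean_measure \<nu>) (\<lambda>p. indicator {0..t} (fst p) *\<^sub>R h (snd p))"
    unfolding jump_mean_measure_def
  proof (rule Fubini_integrable)
    show "integrable ?Q (\<lambda>x. \<integral>y. norm (indicator {0..t} (fst (x, y)) *\<^sub>R h (snd (x, y))) \<partial>\<nu>)"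
      using ind by simp
  qed (use h in auto)
  have "(\<integral>p. indicator {0..t} (fst p) *\<^sub>R h (snd p) \<partial>jump_mean_measure \<nu>)
      = (\<integral>x. (\<integral>y. indicator {0..t} x *\<^sub>R h y \<partial>\<nu>) \<partial>?Q)"
    using integral_fst'[OF int[unfolded jump_mean_measure_def]]
    by (simp add: jump_mean_measure_def)
  also have "\<dots> = (\<integral>x. indicator {0..t} x *\<^sub>R (\<integral>y. h y \<partial>\<nu>) \<partial>?Q)"
    using h by simp
  also have "\<dots> = measure ?Q ({0..t} \<inter> space ?Q) *\<^sub>R (\<integral>y. h y \<partial>\<nu>)"
    using mQ by (subst integral_scaleR_left) (auto simp: space_restrict_space Int_absorb2 Int_absorb1)
  also have "measure ?Q ({0..t} \<inter> space ?Q) = t"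
    using mQ t by (simp add: space_restrict_space measure_def Int_absorb2 Int_absorb1)
  finally show "(\<integral>p. indicator {0..t} (fst p) *\<^sub>R h (snd p) \<partial>jump_mean_measure \<nu>) = t *\<^sub>R (\<integral>x. h x \<partial>\<nu>)" .
qed

section \<open>Characteristic function of a symmetric pure jump process\<close>

context prob_space
begin

text \<open>The map sending x to \<open>iexp (u * x)\<close> is Lipschitz with constant
  \<open>\<bar>u\<bar>\<close>, and the first absolute moment is at most the root of the second
  moment. It carries the mean-square limit that defines the compensated small jumps over to
  characteristic functions.\<close>

lemma char_diff_le_L2:
  assumes [measurable]: "random_variable borel X" "random_variable borel Y"
    and fin: "(\<integral>\<^sup>+\<omega>. ennreal ((X \<omega> - Y \<omega>)\<^sup>2) \<partial>M) < \<infinity>"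
  shows "norm (char (distr M borel X) u - char (distr M borel Y) u)
    \<le> \<bar>u\<bar> * sqrt (enn2real (\<integral>\<^sup>+\<omega>. ennreal ((X \<omega> - Y \<omega>)\<^sup>2) \<partial>M))"
proof -
  define Z where "Z = (\<lambda>\<omega>. \<bar>X \<omega> - Y \<omega>\<bar>)"
  have [measurable]: "random_variable borel Z" unfolding Z_def by measurable
  have Z2: "(Z \<omega>)\<^sup>2 = (X \<omega> - Y \<omega>)\<^sup>2" for \<omega> by (simp add: Z_def)
  have intZ2: "integrable M (\<lambda>\<omega>. (Z \<omega>)\<^sup>2)"
    using fin by (auto simp: integrable_iff_bounded Z2)
  then have intZ: "integrable M Z"
    by (rule square_integrable_imp_integrable[rotated]) measurable
  have EZ2: "expectation (\<lambda>\<omega>. (Z \<omega>)\<^sup>2) = enn2real (\<integral>\<^sup>+\<omega>. ennreal ((X \<omega> - Y \<omega>)\<^sup>2) \<partial>M)"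
    unfolding Z2 by (rule integral_eq_nn_integral) auto
  have "(expectation Z)\<^sup>2 \<le> expectation (\<lambda>\<omega>. (Z \<omega>)\<^sup>2)"
    using variance_positive[of Z] variance_eq[OF intZ intZ2] by simp
  then have EZ: "expectation Z \<le> sqrt (expectation (\<lambda>\<omega>. (Z \<omega>)\<^sup>2))"
    by (rule real_le_rsqrt)
  have lip: "norm (iexp (u * X \<omega>) - iexp (u * Y \<omega>)) \<le> \<bar>u\<bar> * Z \<omega>" for \<omega>
  proof -
    have "iexp (u * X \<omega>) - iexp (u * Y \<omega>) = iexp (u * Y \<omega>) * (iexp (u * X \<omega> - u * Y \<omega>) - 1)"
      by (simp add: algebra_simps flip: exp_add)
    then have "norm (iexp (u * X \<omega>) - iexp (u * Y \<omega>)) = norm (iexp (u * X \<omega> - u * Y \<omega>) - 1)"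
      by (simp add: norm_mult)
    also have "\<dots> \<le> \<bar>u * X \<omega> - u * Y \<omega>\<bar>"
      using iexp_approx1[of "u * X \<omega> - u * Y \<omega>" 0] by simp
    finally show ?thesis by (simp add: Z_def abs_mult flip: right_diff_distrib)
  qed
  have i: "integrable M (\<lambda>\<omega>. iexp (u * X \<omega>))" "integrable M (\<lambda>\<omega>. iexp (u * Y \<omega>))"
    by (auto intro!: integrable_const_bound[where B = 1])
  have "char (distr M borel X) u - char (distr M borel Y) u
      = (\<integral>\<omega>. iexp (u * X \<omega>) - iexp (u * Y \<omega>) \<partial>M)"
    unfolding char_def
    using i by (subst (1 2) integral_distr) auto
  also have "norm \<dots> \<le> (\<integral>\<omega>. norm (iexp (u * X \<omega>) - iexp (u * Y \<omega>)) \<partial>M)"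
    by (rule integral_norm_bound)
  also have "\<dots> \<le> (\<integral>\<omega>. \<bar>u\<bar> * Z \<omega> \<partial>M)"
    using lip intZ i by (intro integral_mono) auto
  also have "\<dots> \<le> \<bar>u\<bar> * sqrt (expectation (\<lambda>\<omega>. (Z \<omega>)\<^sup>2))"
    using EZ by (simp add: mult_left_mono)
  finally show ?thesis by (simp add: EZ2)
qed

text \<open>Jumps of size above e have finite mass, so the formula for Poisson integrals applies to
  them. Symmetry of \<nu> removes both the compensator and the sine part, leaving a real
  exponent.\<close>

lemma large_jumps_char:
  assumes N: "poisson_random_measure (jump_mean_measure \<nu>) N"
    and sf: "sigma_finite_measure \<nu>" and sym: "distr \<nu> borel uminus = \<nu>"
    and int2: "integrable \<nu> (\<lambda>x. x\<^sup>2)" and t: "0 \<le> t" and e: "0 < e" "e < 1"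
  obtains T where "random_variable borel T"
    "AE \<omega> in M. T \<omega> = jump_integral (N \<omega>) t {x. e < \<bar>x\<bar> \<and> \<bar>x\<bar> \<le> 1} + jump_integral (N \<omega>) t {x. \<bar>x\<bar> > 1}"
    "jump_integral (jump_mean_measure \<nu>) t {x. e < \<bar>x\<bar> \<and> \<bar>x\<bar> \<le> 1} = 0"
    "\<And>u. char (distr M borel T) u = exp (of_real (t * (\<integral>x. indicator {x. e < \<bar>x\<bar>} x * (cos (u * x) - 1) \<partial>\<nu>)))"
proof -
  let ?m = "jump_mean_measure \<nu>"
  have [measurable_cong]: "sets \<nu> = sets borel"
    using sets_distr[of \<nu> borel uminus] unfolding sym .
  define f where "f B p = indicator {0..t} (fst p) *\<^sub>R (indicator B (snd p) *\<^sub>R snd p)"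
    for B :: "real set" and p :: "real \<times> real"
  have f: "jump_integral R t B = (\<integral>p. f B p \<partial>R)" for R B
    unfolding jump_integral_def set_lebesgue_integral_def f_def
    by (intro Bochner_Integration.integral_cong) (auto simp: indicator_def)
  \<comment> \<open>Chebyshev-type bounds. The first makes x integrable over the jumps above e, the
    second makes the mass of these jumps finite.\<close>
  have sq: "\<bar>indicator B x * x\<bar> \<le> x\<^sup>2 / e" "indicator B x \<le> x\<^sup>2 / e\<^sup>2" if "\<And>x. x \<in> B \<Longrightarrow> e < \<bar>x\<bar>" for B and x :: real
  proof -
    show "\<bar>indicator B x * x\<bar> \<le> x\<^sup>2 / e"
    proof (cases "x \<in> B")
      case True
      then have "\<bar>x\<bar> * e \<le> \<bar>x\<bar> * \<bar>x\<bar>" using that by (intro mult_left_mono) fastforce+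
      then show ?thesis using True e by (simp add: field_simps power2_eq_square)
    qed (use e in simp)
    show "indicator B x \<le> x\<^sup>2 / e\<^sup>2"
    proof (cases "x \<in> B")
      case True
      then have "e\<^sup>2 \<le> \<bar>x\<bar>\<^sup>2" using that[OF True] e by (intro power_mono) auto
      then show ?thesis using True e by (simp add: field_simps)
    qed simp
  qed
  have intx: "integrable \<nu> (\<lambda>x. indicator B x *\<^sub>R x)"
    if "B \<in> sets borel" "\<And>x. x \<in> B \<Longrightarrow> e < \<bar>x\<bar>" for B
  proof (rule Bochner_Integration.integrable_bound)
    show "integrable \<nu> (\<lambda>x. x\<^sup>2 / e)" using int2 by simp
    show "(\<lambda>x. indicator B x *\<^sub>R x) \<in> borel_measurable \<nu>" using that by measurable
  qed (use sq(1)[OF that(2)] e in auto)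
  have int1: "integrable \<nu> (indicator {x. e < \<bar>x\<bar>} :: real \<Rightarrow> real)"
  proof (rule Bochner_Integration.integrable_bound)
    show "integrable \<nu> (\<lambda>x. x\<^sup>2 / e\<^sup>2)" using int2 by simp
  qed (use sq(2)[of "{x. e < \<bar>x\<bar>}"] in auto)
  define B1 where "B1 = {x. e < \<bar>x\<bar> \<and> \<bar>x\<bar> \<le> 1}"
  define B2 where "B2 = {x. \<bar>x\<bar> > (1::real)}"
  define B where "B = {x. e < \<bar>x\<bar>}"
  have Bm[measurable]: "B1 \<in> sets borel" "B2 \<in> sets borel" "B \<in> sets borel"
    unfolding B1_def B2_def B_def by measurable
  have Be: "\<And>x. x \<in> B1 \<Longrightarrow> e < \<bar>x\<bar>" "\<And>x. x \<in> B2 \<Longrightarrow> e < \<bar>x\<bar>" "\<And>x. x \<in> B \<Longrightarrow> e < \<bar>x\<bar>"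
    using e by (auto simp: B1_def B2_def B_def)
  note intB = intx[OF Bm(1) Be(1)] intx[OF Bm(2) Be(2)] intx[OF Bm(3) Be(3)]
  have intf: "integrable ?m (f B1)" "integrable ?m (f B2)" "integrable ?m (f B)"
    unfolding f_def using jump_mean_measure_integral(1)[OF sf _ t] intB by blast+
  \<comment> \<open>Both ranges of jumps are merged into one integrand, which is possible as e is
    below 1; one characteristic function then covers their sum.\<close>
  have f_add: "f B = (\<lambda>p. f B1 p + f B2 p)"
    using e by (auto simp: fun_eq_iff f_def B1_def B2_def B_def indicator_def)
  have odd0: "(\<integral>x. indicator B1 x *\<^sub>R x \<partial>\<nu>) = 0"
    by (rule symmetric_integral_odd[OF sym]) (auto simp: B1_def indicator_def)
  have comp: "jump_integral ?m t B1 = 0"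
    by (simp only: f f_def jump_mean_measure_integral(2)[OF sf intB(1) t] odd0 scaleR_zero_right)
  \<comment> \<open>The finite mass of the strip \<open>{0..t} \<times> B\<close>, which contains
    the support of \<open>f B\<close>, is read off from the integrability of its indicator.\<close>
  have "integrable ?m (\<lambda>p. indicator {0..t} (fst p) *\<^sub>R indicator B (snd p) :: real)"
    using int1 by (intro jump_mean_measure_integral(1)[OF sf _ t]) (simp add: B_def)
  also have "(\<lambda>p. indicator {0..t} (fst p) *\<^sub>R indicator B (snd p) :: real) = indicator ({0..t} \<times> B)"
    by (auto simp: indicator_def fun_eq_iff)
  finally have "emeasure ?m (({0..t} \<times> B) \<inter> space ?m) < \<infinity>" "({0..t} \<times> B) \<inter> space ?m \<in> sets ?m"
    by (simp_all add: integrable_indicator_iff)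
  moreover have "{p \<in> space ?m. f B p \<noteq> 0} \<subseteq> ({0..t} \<times> B) \<inter> space ?m"
    by (auto simp: f_def split: split_indicator_asm)
  ultimately have fin: "emeasure ?m {p \<in> space ?m. f B p \<noteq> 0} < \<infinity>"
    using emeasure_mono le_less_trans by blast
  obtain T where T: "random_variable borel T" "AE \<omega> in M. T \<omega> = (\<integral>p. f B p \<partial>N \<omega>)"
    "\<And>u. char (distr M borel T) u = exp (\<integral>p. iexp (u * f B p) - 1 \<partial>?m)"
    by (rule poisson_integral_char[OF N intf(3) fin]) blast
  have "AE \<omega> in M. T \<omega> = jump_integral (N \<omega>) t B1 + jump_integral (N \<omega>) t B2"
    using T(2) poisson_integrable_AE[OF N intf(1)] poisson_integrable_AE[OF N intf(2)]
    by eventually_elim (simp add: f f_add)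
  moreover have "char (distr M borel T) u = exp (of_real (t * (\<integral>x. indicator B x * (cos (u * x) - 1) \<partial>\<nu>)))" for u
  proof -
    let ?h = "\<lambda>x. indicator B x *\<^sub>R (iexp (u * x) - 1)"
    let ?c = "\<lambda>x. indicator B x * (cos (u * x) - 1)" and ?s = "\<lambda>x. indicator B x * sin (u * x)"
    have B_int: "integrable \<nu> (\<lambda>x. indicator B x * g x)"
      if [measurable]: "g \<in> borel_measurable borel" and g: "\<And>x. \<bar>g x\<bar> \<le> 2" for g :: "real \<Rightarrow> real"
    proof (rule Bochner_Integration.integrable_bound)
      show "integrable \<nu> (\<lambda>x. 2 * indicator B x :: real)"
        using int1 by (simp add: B_def)
      show "AE x in \<nu>. norm (indicator B x * g x) \<le> norm (2 * indicator B x :: real)"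
        using g by (intro AE_I2) (simp add: indicator_def)
    qed measurable
    have cos_bound: "\<bar>cos x - 1\<bar> \<le> 2" for x :: real
      using cos_le_one[of x] cos_ge_minus_one[of x] by linarith
    have sin_bound: "\<bar>sin x\<bar> \<le> 2" for x :: real
      using abs_sin_le_one[of x] by linarith
    have ic: "integrable \<nu> ?c"
      by (rule B_int) (use cos_bound in measurable)
    have isn: "integrable \<nu> ?s"
      by (rule B_int) (use sin_bound in measurable)
    have h: "?h x = of_real (?c x) + \<i> * of_real (?s x)" for x
      by (simp add: indicator_def exp_Euler flip: cos_of_real sin_of_real)
    have ih: "integrable \<nu> ?h"
      unfolding h using ic isn
      by (intro Bochner_Integration.integrable_add integrable_mult_right integrable_of_real)
    have "(\<integral>p. iexp (u * f B p) - 1 \<partial>?m) = (\<integral>p. indicator {0..t} (fst p) *\<^sub>R ?h (snd p) \<partial>?m)"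
      by (intro Bochner_Integration.integral_cong) (auto simp: f_def indicator_def)
    also have "\<dots> = t *\<^sub>R (\<integral>x. ?h x \<partial>\<nu>)"
      by (rule jump_mean_measure_integral(2)[OF sf ih t])
    also have "(\<integral>x. ?h x \<partial>\<nu>) = of_real (\<integral>x. ?c x \<partial>\<nu>) + \<i> * of_real (\<integral>x. ?s x \<partial>\<nu>)"
      unfolding h using ic isn
      by (simp only: Bochner_Integration.integral_add integrable_mult_right integrable_of_real
          integral_mult_right_zero integral_complex_of_real)
    also have "(\<integral>x. ?s x \<partial>\<nu>) = 0"
        by (rule symmetric_integral_odd[OF sym]) (auto simp: B_def split: split_indicator)
    finally show ?thesis
      unfolding T(3)
      by (simp only: scaleR_conv_of_real of_real_0 mult_zero_right add_0_right of_real_mult)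
  qed
  ultimately show ?thesis
    using that[OF T(1)] comp by (simp add: B1_def B2_def B_def)
qed

text \<open>The jumps of size above e converge to \<open>X t\<close> in mean square as e tends to 0,
  hence so do their characteristic functions. The exponents converge by domination with
  \<open>u\<^sup>2 * x\<^sup>2\<close>.\<close>

lemma symmetric_pure_jump_char:
  assumes X: "has_levy_triplet X 0 0 \<nu>" and Xt[measurable]: "random_variable borel (X t)"
    and t: "0 \<le> t" and sf: "sigma_finite_measure \<nu>" and sym: "distr \<nu> borel uminus = \<nu>"
    and int2: "integrable \<nu> (\<lambda>x. x\<^sup>2)"
  shows "char (distr M borel (X t)) u = exp (of_real (t * (\<integral>x. cos (u * x) - 1 \<partial>\<nu>)))"
proof -
  let ?m = "jump_mean_measure \<nu>"
  have [measurable_cong]: "sets \<nu> = sets borel"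
    using sets_distr[of \<nu> borel uminus] unfolding sym .
  obtain N Y where N: "poisson_random_measure ?m N"
    and Y: "\<And>t. t \<ge> 0 \<Longrightarrow> compensated_small_jumps ?m N t (Y t)"
    and XY: "\<And>t. t \<ge> 0 \<Longrightarrow> AE \<omega> in M. X t \<omega> = Y t \<omega> + jump_integral (N \<omega>) t {x. \<bar>x\<bar> > 1}"
    using X unfolding has_levy_triplet_def by auto
  \<comment> \<open>Any sequence decreasing to 0 inside the open unit interval would do; the shift
    by 2 keeps every term strictly below 1.\<close>
  define e :: "nat \<Rightarrow> real" where "e n = 1 / real (n + 2)" for n
  have e: "0 < e n" "e n < 1" for n by (auto simp: e_def)
  have e_lim: "e \<longlonglongrightarrow> 0" unfolding e_def by real_asymp
  have e_right: "filterlim e (at_right 0) sequentially"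
    using e_lim e by (auto simp: filterlim_at less_imp_neq[OF e(1), symmetric])
  let ?c = "\<lambda>e. \<integral>x. indicator {x. e < \<bar>x\<bar>} x * (cos (u * x) - 1) \<partial>\<nu>"
  have "\<exists>T. random_variable borel T \<and>
    (AE \<omega> in M. T \<omega> = jump_integral (N \<omega>) t {x. e n < \<bar>x\<bar> \<and> \<bar>x\<bar> \<le> 1} + jump_integral (N \<omega>) t {x. \<bar>x\<bar> > 1}) \<and>
    jump_integral ?m t {x. e n < \<bar>x\<bar> \<and> \<bar>x\<bar> \<le> 1} = 0 \<and>
    char (distr M borel T) u = exp (of_real (t * ?c (e n)))" for n
    by (rule large_jumps_char[OF N sf sym int2 t e(1)[of n] e(2)[of n]]) (rule exI, intro conjI, assumption+)
  then have "\<exists>T. \<forall>n. random_variable borel (T n) \<and>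
    (AE \<omega> in M. T n \<omega> = jump_integral (N \<omega>) t {x. e n < \<bar>x\<bar> \<and> \<bar>x\<bar> \<le> 1} + jump_integral (N \<omega>) t {x. \<bar>x\<bar> > 1}) \<and>
    jump_integral ?m t {x. e n < \<bar>x\<bar> \<and> \<bar>x\<bar> \<le> 1} = 0 \<and>
    char (distr M borel (T n)) u = exp (of_real (t * ?c (e n)))"
    by (intro choice allI)
  then obtain T where T[measurable]: "\<And>n. random_variable borel (T n)"
    and T_eq: "\<And>n. AE \<omega> in M. T n \<omega> = jump_integral (N \<omega>) t {x. e n < \<bar>x\<bar> \<and> \<bar>x\<bar> \<le> 1} + jump_integral (N \<omega>) t {x. \<bar>x\<bar> > 1}"
    and comp: "\<And>n. jump_integral ?m t {x. e n < \<bar>x\<bar> \<and> \<bar>x\<bar> \<le> 1} = 0"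
    and T_char: "\<And>n. char (distr M borel (T n)) u = exp (of_real (t * ?c (e n)))"
    by blast
  define D where "D n = (\<integral>\<^sup>+\<omega>. ennreal ((T n \<omega> - X t \<omega>)\<^sup>2) \<partial>M)" for n
  \<comment> \<open>The large jumps cancel between \<open>T n\<close> and \<open>X t\<close> and the
    compensator is 0, so \<open>D n\<close> is the very quantity whose limit is prescribed by
    \<open>compensated_small_jumps\<close>.\<close>
  have D_eq: "D n = (\<integral>\<^sup>+\<omega>. ennreal ((Y t \<omega> - (jump_integral (N \<omega>) t {x. e n < \<bar>x\<bar> \<and> \<bar>x\<bar> \<le> 1}
      - jump_integral ?m t {x. e n < \<bar>x\<bar> \<and> \<bar>x\<bar> \<le> 1}))\<^sup>2) \<partial>M)" for n
    unfolding D_def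
  proof (rule nn_integral_cong_AE)
    show "AE \<omega> in M. ennreal ((T n \<omega> - X t \<omega>)\<^sup>2) = ennreal ((Y t \<omega> - (jump_integral (N \<omega>) t {x. e n < \<bar>x\<bar> \<and> \<bar>x\<bar> \<le> 1}
      - jump_integral ?m t {x. e n < \<bar>x\<bar> \<and> \<bar>x\<bar> \<le> 1}))\<^sup>2)"
      using T_eq[of n] XY[OF t] by eventually_elim (simp add: comp power2_commute)
  qed
  have D: "D \<longlonglongrightarrow> 0"
    unfolding D_eq[abs_def]
    by (rule filterlim_compose[OF Y[OF t, unfolded compensated_small_jumps_def, THEN conjunct2] e_right])
  then have d: "(\<lambda>n. \<bar>u\<bar> * sqrt (enn2real (D n))) \<longlonglongrightarrow> 0"
    using tendsto_mult_right_zero[of "\<lambda>n. sqrt (enn2real (D n))"]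
      tendsto_real_sqrt[OF tendsto_enn2real[of D 0]] by simp
  \<comment> \<open>Finiteness comes first because \<open>enn2real\<close> sends infinity to 0,
    which would make the mean-square bound meaningless.\<close>
  have "eventually (\<lambda>n. D n < \<infinity>) sequentially"
    using D by (intro order_tendstoD) auto
  then have "eventually (\<lambda>n. norm (char (distr M borel (T n)) u - char (distr M borel (X t)) u) \<le> \<bar>u\<bar> * sqrt (enn2real (D n))) sequentially"
    by eventually_elim (simp add: D_def char_diff_le_L2)
  then have "(\<lambda>n. char (distr M borel (T n)) u - char (distr M borel (X t)) u) \<longlonglongrightarrow> 0"
    using d by (rule Lim_null_comparison)
  then have "(\<lambda>n. char (distr M borel (T n)) u) \<longlonglongrightarrow> char (distr M borel (X t)) u"
    by (simp add: LIM_zero_iff)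
  moreover have "(\<lambda>n. ?c (e n)) \<longlonglongrightarrow> (\<integral>x. cos (u * x) - 1 \<partial>\<nu>)"
  proof (rule integral_dominated_convergence[where w = "\<lambda>x. u\<^sup>2 * x\<^sup>2"])
    show "integrable \<nu> (\<lambda>x. u\<^sup>2 * x\<^sup>2)" using int2 by simp
    show "AE x in \<nu>. (\<lambda>n. indicator {x. e n < \<bar>x\<bar>} x * (cos (u * x) - 1)) \<longlonglongrightarrow> cos (u * x) - 1"
    proof (intro AE_I2)
      fix x
      show "(\<lambda>n. indicator {x. e n < \<bar>x\<bar>} x * (cos (u * x) - 1)) \<longlonglongrightarrow> cos (u * x) - 1"
      proof (cases "x = 0")
        case False
        then have "eventually (\<lambda>n. e n < \<bar>x\<bar>) sequentially"
          using e_lim by (intro order_tendstoD) auto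
        then show ?thesis
          by (intro tendsto_eventually) (erule eventually_mono, simp)
      qed simp
    qed
    show "AE x in \<nu>. norm (indicator {x. e n < \<bar>x\<bar>} x * (cos (u * x) - 1)) \<le> u\<^sup>2 * x\<^sup>2" for n
      using abs_cos_minus_one_le[of "u * _"] by (auto simp: power_mult_distrib split: split_indicator intro!: AE_I2)
  qed measurable
  then have "(\<lambda>n. char (distr M borel (T n)) u) \<longlonglongrightarrow> exp (of_real (t * (\<integral>x. cos (u * x) - 1 \<partial>\<nu>)))"
    unfolding T_char by (intro tendsto_exp tendsto_of_real tendsto_mult tendsto_const)
  ultimately show ?thesis by (rule LIMSEQ_unique)
qed

end

section \<open>Differentiation under the integral\<close>

text \<open>By the mean value inequality the difference quotients are dominated by w, so dominated
  convergence applies along every sequence tending to u.\<close>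

lemma has_real_derivative_integral:
  fixes f f' :: "real \<Rightarrow> 'a \<Rightarrow> real"
  assumes u: "a < u" "u < b"
    and int: "\<And>v. a < v \<Longrightarrow> v < b \<Longrightarrow> integrable P (f v)"
    and f'_meas: "f' u \<in> borel_measurable P"
    and deriv: "\<And>v x. a < v \<Longrightarrow> v < b \<Longrightarrow> x \<in> space P \<Longrightarrow> ((\<lambda>v. f v x) has_real_derivative f' v x) (at v)"
    and bound: "\<And>v x. a < v \<Longrightarrow> v < b \<Longrightarrow> x \<in> space P \<Longrightarrow> \<bar>f' v x\<bar> \<le> w x"
    and w: "integrable P w"
  shows "((\<lambda>v. \<integral>x. f v x \<partial>P) has_real_derivative (\<integral>x. f' u x \<partial>P)) (at u)"
  unfolding has_field_derivative_iff
proof (subst tendsto_at_iff_sequentially, intro allI impI)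
  fix y :: "nat \<Rightarrow> real"
  assume y: "\<forall>i. y i \<in> UNIV - {u}" and lim: "y \<longlonglongrightarrow> u"
  have "eventually (\<lambda>i. a < y i \<and> y i < b) sequentially"
    using order_tendstoD[OF lim] u by (auto intro: eventually_conj)
  then obtain k where k: "\<And>i. i \<ge> k \<Longrightarrow> a < y i \<and> y i < b"
    by (auto simp: eventually_sequentially)
  \<comment> \<open>Dropping the first k terms puts the whole sequence into the interval from a to
    b, where integrability and the bound are given.\<close>
  define z where "z i = y (i + k)" for i
  have z: "a < z i" "z i < b" "z i \<noteq> u" for i
    using k y by (auto simp: z_def)
  have z_lim: "z \<longlonglongrightarrow> u"
    using lim unfolding z_def by (rule LIMSEQ_ignore_initial_segment)
  let ?q = "\<lambda>i x. (f (z i) x - f u x) / (z i - u)"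
  have "(\<lambda>i. \<integral>x. ?q i x \<partial>P) \<longlonglongrightarrow> (\<integral>x. f' u x \<partial>P)"
  proof (rule integral_dominated_convergence[where w = w])
    show "?q i \<in> borel_measurable P" for i
      using int[OF z(1,2)[of i]] int[OF u] by measurable
    show "AE x in P. (\<lambda>i. ?q i x) \<longlonglongrightarrow> f' u x"
    proof (intro AE_I2)
      fix x assume "x \<in> space P"
      then have "((\<lambda>v. (f v x - f u x) / (v - u)) \<longlongrightarrow> f' u x) (at u)"
        using deriv[OF u] by (simp add: has_field_derivative_iff)
      moreover have "filterlim z (at u) sequentially"
        using z_lim z(3) by (auto simp: filterlim_at)
      ultimately show "(\<lambda>i. ?q i x) \<longlonglongrightarrow> f' u x"
        by (rule filterlim_compose)
    qed
    show "AE x in P. norm (?q i x) \<le> w x" for i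
    proof (intro AE_I2)
      fix x assume x: "x \<in> space P"
      have "norm (f (z i) x - f u x) \<le> w x * norm (z i - u)"
        using deriv bound x u z
        by (intro field_differentiable_bound[of "{a<..<b}" "\<lambda>v. f v x" "\<lambda>v. f' v x"])
          (auto intro: DERIV_subset)
      then show "norm (?q i x) \<le> w x"
        using z(3)[of i] by (simp add: divide_le_eq)
    qed
  qed (use f'_meas w in auto)
  moreover have "(\<integral>x. ?q i x \<partial>P) = ((\<integral>x. f (z i) x \<partial>P) - (\<integral>x. f u x \<partial>P)) / (z i - u)" for i
    using int[OF z(1,2)[of i]] int[OF u] by simp
  ultimately have "(\<lambda>i. ((\<integral>x. f (z i) x \<partial>P) - (\<integral>x. f u x \<partial>P)) / (z i - u)) \<longlonglongrightarrow> (\<integral>x. f' u x \<partial>P)"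
    by (simp only:)
  from LIMSEQ_offset[OF this[unfolded z_def]] show "((\<lambda>v. ((\<integral>x. f v x \<partial>P) - (\<integral>x. f u x \<partial>P)) / (v - u)) \<circ> y) \<longlonglongrightarrow> (\<integral>x. f' u x \<partial>P)"
    by (simp add: comp_def)
qed

section \<open>Scaled exponentials and their derivatives\<close>

lemma poly_exp_bounded:
  fixes p :: "real poly"
  obtains C where "\<And>x. 0 \<le> x \<Longrightarrow> \<bar>poly p x * exp (- x)\<bar> \<le> C"
proof
  fix x :: real assume x: "0 \<le> x"
  \<comment> \<open>A single term of the exponential series is at most its sum, all terms being
    nonnegative.\<close>
  have pow: "x ^ i \<le> fact i * exp x" for i
  proof -
    have "x ^ i /\<^sub>R fact i \<le> exp x"
      using x sum_le_suminf[OF summable_exp_generic[of x], of "{i}"] by (auto simp: exp_def)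
    then show ?thesis by (simp add: field_simps)
  qed
  have "\<bar>poly p x\<bar> \<le> (\<Sum>i\<le>degree p. \<bar>coeff p i\<bar> * x ^ i)"
    unfolding poly_altdef using x by (intro sum_abs[THEN order_trans]) (simp add: abs_mult)
  also have "\<dots> \<le> (\<Sum>i\<le>degree p. \<bar>coeff p i\<bar> * (fact i * exp x))"
    using pow by (intro sum_mono mult_left_mono) auto
  also have "\<dots> = (\<Sum>i\<le>degree p. \<bar>coeff p i\<bar> * fact i) * exp x"
    by (simp add: sum_distrib_right mult.assoc)
  finally show "\<bar>poly p x * exp (- x)\<bar> \<le> (\<Sum>i\<le>degree p. \<bar>coeff p i\<bar> * fact i)"
    by (simp add: abs_mult exp_minus field_simps)
qed

text \<open>The \<open>n\<close>-th derivative of \<open>u \<mapsto> u\<^sup>\<alpha> exp (- x / u)\<close> is \<open>u\<^bsup>\<alpha> - n\<^esup> p\<^sub>n (x / u) exp (- x / u)\<close> with the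
  following polynomials \<open>p\<^sub>n\<close>.\<close>

primrec scaled_exp_poly :: "real \<Rightarrow> nat \<Rightarrow> real poly" where
  "scaled_exp_poly \<alpha> 0 = 1"
| "scaled_exp_poly \<alpha> (Suc n) = smult (\<alpha> - real n) (scaled_exp_poly \<alpha> n)
     + pCons 0 (scaled_exp_poly \<alpha> n - pderiv (scaled_exp_poly \<alpha> n))"

definition scaled_exp_deriv :: "real \<Rightarrow> nat \<Rightarrow> real \<Rightarrow> real \<Rightarrow> real" where
  "scaled_exp_deriv \<alpha> n u x = u powr (\<alpha> - real n) * (poly (scaled_exp_poly \<alpha> n) (x / u) * exp (- (x / u)))"

text \<open>With y = x/u, the derivative of y in u is -y/u. The product rule therefore lowers the
  power of u by one and replaces p by (\<alpha> - n) p + y (p - p'), which is the recursion of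
  \<open>scaled_exp_poly\<close>.\<close>

lemma has_real_derivative_scaled_exp:
  assumes "0 < u"
  shows "((\<lambda>u. scaled_exp_deriv \<alpha> n u x) has_real_derivative scaled_exp_deriv \<alpha> (Suc n) u x) (at u)"
proof -
  let ?p = "scaled_exp_poly \<alpha> n"
  have e: "u powr (\<alpha> - real (Suc n)) = u powr (\<alpha> - real n) / u"
    using assms powr_diff[of u "\<alpha> - real n" 1] by (simp add: algebra_simps)
  have q: "((\<lambda>u. x / u) has_real_derivative - (x / u) / u) (at u)"
    using assms by (auto intro!: derivative_eq_intros simp: field_simps)
  have w: "((\<lambda>u. u powr (\<alpha> - real n)) has_real_derivative (\<alpha> - real n) * u powr (\<alpha> - real n) / u) (at u)"
    using has_real_derivative_powr[OF assms, of "\<alpha> - real n"] powr_diff[of u "\<alpha> - real n" 1] assms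
    by simp
  note p = DERIV_chain2[OF poly_DERIV[of ?p] q]
  note ex = DERIV_chain2[OF DERIV_exp DERIV_minus[OF q]]
  show ?thesis
    unfolding scaled_exp_deriv_def
    by (rule DERIV_cong[OF DERIV_mult[OF w DERIV_mult[OF p ex]]], unfold e)
      (simp add: algebra_simps add_divide_distrib diff_divide_distrib)
qed

text \<open>Apart from the power of u, the function depends on x/u alone, so C can be chosen
  independently of both u and x.\<close>

lemma scaled_exp_deriv_bound:
  obtains C where "\<And>u x. 0 < u \<Longrightarrow> 0 \<le> x \<Longrightarrow> \<bar>scaled_exp_deriv \<alpha> n u x\<bar> \<le> C * u powr (\<alpha> - real n)"
proof -
  obtain C where C: "\<And>x. 0 \<le> x \<Longrightarrow> \<bar>poly (scaled_exp_poly \<alpha> n) x * exp (- x)\<bar> \<le> C"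
    by (rule poly_exp_bounded[of "scaled_exp_poly \<alpha> n"]) blast
  show ?thesis
  proof (rule that)
    fix u x :: real assume "0 < u" "0 \<le> x"
    then show "\<bar>scaled_exp_deriv \<alpha> n u x\<bar> \<le> C * u powr (\<alpha> - real n)"
      using mult_left_mono[OF C[of "x / u"], of "u powr (\<alpha> - real n)"]
      by (simp add: scaled_exp_deriv_def abs_mult mult_ac)
  qed
qed

text \<open>The pointwise bound is uniform in \<open>Z x\<close>, so over a finite measure it
  survives integration with the same power of u, and it also supplies the domination for
  differentiating under the integral.\<close>

lemma (in finite_measure) scaled_laplace_derivatives:
  fixes Z :: "'a \<Rightarrow> real" and \<alpha> :: real
  assumes Z[measurable]: "Z \<in> borel_measurable M" and Z0: "\<And>x. x \<in> space M \<Longrightarrow> 0 \<le> Z x"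
  defines "G \<equiv> \<lambda>n u. \<integral>x. scaled_exp_deriv \<alpha> n u (Z x) \<partial>M"
  shows scaled_laplace_has_derivative: "0 < u \<Longrightarrow> (G n has_real_derivative G (Suc n) u) (at u)"
    and scaled_laplace_bound: "\<exists>C. \<forall>u>0. \<bar>G n u\<bar> \<le> C * u powr (\<alpha> - real n)"
proof -
  have meas[measurable]: "(\<lambda>x. scaled_exp_deriv \<alpha> n u (Z x)) \<in> borel_measurable M" for n u
    unfolding scaled_exp_deriv_def
    by (intro borel_measurable_times measurable_compose[OF _ borel_measurable_continuous_onI[of "poly _"]]
        continuous_intros) measurable
  have bnd: "\<exists>C\<ge>0. \<forall>u>0. \<forall>x\<in>space M. \<bar>scaled_exp_deriv \<alpha> n u (Z x)\<bar> \<le> C * u powr (\<alpha> - real n)" for n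
  proof -
    obtain C where "\<And>u x. 0 < u \<Longrightarrow> 0 \<le> x \<Longrightarrow> \<bar>scaled_exp_deriv \<alpha> n u x\<bar> \<le> C * u powr (\<alpha> - real n)"
      by (rule scaled_exp_deriv_bound) blast
    with Z0 have *: "\<bar>scaled_exp_deriv \<alpha> n u (Z x)\<bar> \<le> C * u powr (\<alpha> - real n)"
      if "0 < u" "x \<in> space M" for u x using that by blast
    have "C * u powr (\<alpha> - real n) \<le> max C 0 * u powr (\<alpha> - real n)" for u
      by (intro mult_right_mono) auto
    with * show ?thesis
      by (intro exI[of _ "max C 0"]) (fastforce intro: order_trans)
  qed
  have int: "integrable M (\<lambda>x. scaled_exp_deriv \<alpha> n u (Z x))" if "0 < u" for n u
  proof -
    obtain C where "\<forall>u>0. \<forall>x\<in>space M. \<bar>scaled_exp_deriv \<alpha> n u (Z x)\<bar> \<le> C * u powr (\<alpha> - real n)"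
      using bnd by blast
    with that show ?thesis
      by (intro integrable_const_bound[where B = "C * u powr (\<alpha> - real n)"]) auto
  qed
  show "\<exists>C. \<forall>u>0. \<bar>G n u\<bar> \<le> C * u powr (\<alpha> - real n)"
  proof -
    obtain C where C: "\<And>u x. 0 < u \<Longrightarrow> x \<in> space M \<Longrightarrow> \<bar>scaled_exp_deriv \<alpha> n u (Z x)\<bar> \<le> C * u powr (\<alpha> - real n)"
      using bnd by blast
    have "\<bar>G n u\<bar> \<le> (C * measure M (space M)) * u powr (\<alpha> - real n)" if "0 < u" for u
    proof -
      have "\<bar>G n u\<bar> \<le> (\<integral>x. \<bar>scaled_exp_deriv \<alpha> n u (Z x)\<bar> \<partial>M)"
        unfolding G_def by (rule integral_abs_bound)
      also have "\<dots> \<le> (\<integral>x. C * u powr (\<alpha> - real n) \<partial>M)"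
        using that int C by (intro integral_mono) auto
      finally show ?thesis by (simp add: mult_ac)
    qed
    then show ?thesis by blast
  qed
  show "(G n has_real_derivative G (Suc n) u) (at u)" if u: "0 < u"
  proof -
    obtain C where C: "0 \<le> C" "\<And>u x. 0 < u \<Longrightarrow> x \<in> space M \<Longrightarrow>
        \<bar>scaled_exp_deriv \<alpha> (Suc n) u (Z x)\<bar> \<le> C * u powr (\<alpha> - real (Suc n))"
      using bnd by blast
    \<comment> \<open>The exponent may have either sign, so on the interval from u/2 to 2u the power
      is bounded by the larger of its two endpoint values.\<close>
    define B where "B = max ((u / 2) powr (\<alpha> - real (Suc n))) ((2 * u) powr (\<alpha> - real (Suc n)))"
    have B: "v powr (\<alpha> - real (Suc n)) \<le> B" if "u / 2 < v" "v < 2 * u" for v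
    proof (cases "\<alpha> - real (Suc n) \<ge> 0")
      case True
      then have "v powr (\<alpha> - real (Suc n)) \<le> (2 * u) powr (\<alpha> - real (Suc n))"
        using that u by (intro powr_mono2) auto
      then show ?thesis by (simp add: B_def)
    next
      case False
      then have "v powr (\<alpha> - real (Suc n)) \<le> (u / 2) powr (\<alpha> - real (Suc n))"
        using that u by (intro powr_mono2') auto
      then show ?thesis by (simp add: B_def)
    qed
    show ?thesis
      unfolding G_def
    proof (rule has_real_derivative_integral[of "u / 2" u "2 * u"])
      fix v x assume v: "u / 2 < v" "v < 2 * u" and x: "x \<in> space M"
      from v u have "0 < v" by linarith
      then show "((\<lambda>v. scaled_exp_deriv \<alpha> n v (Z x)) has_real_derivative scaled_exp_deriv \<alpha> (Suc n) v (Z x)) (at v)"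
        by (rule has_real_derivative_scaled_exp)
      show "\<bar>scaled_exp_deriv \<alpha> (Suc n) v (Z x)\<bar> \<le> C * B"
        using C(2)[OF \<open>0 < v\<close> x] mult_left_mono[OF B[OF v] C(1)] by (rule order_trans)
    qed (use u int in auto)
  qed
qed

section \<open>Derivatives of the cosine integral\<close>

text \<open>The \<open>n\<close>-th derivative of \<open>u \<mapsto> cos (u x) - 1\<close>.\<close>

definition cos_deriv :: "nat \<Rightarrow> real \<Rightarrow> real \<Rightarrow> real" where
  "cos_deriv n u x = (if n = 0 then cos (u * x) - 1 else x ^ n * cos (u * x + real n * (pi / 2)))"

lemma has_real_derivative_cos_deriv:
  "((\<lambda>u. cos_deriv n u x) has_real_derivative cos_deriv (Suc n) u x) (at u)"
proof -
  have c: "cos (y + real (Suc n) * (pi / 2)) = - sin (y + real n * (pi / 2))" for y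
  proof -
    have "y + real (Suc n) * (pi / 2) = (y + real n * (pi / 2)) + pi / 2"
      by (simp add: algebra_simps)
    then show ?thesis by (simp only: cos_add) simp
  qed
  show ?thesis
    unfolding cos_deriv_def c[of "u * x"]
    by (cases "n = 0") (auto intro!: derivative_eq_intros simp: c)
qed

text \<open>Up to the evenness of the cosine, negating u shifts the phase by n times pi. This parity
  later reduces negative u to positive u.\<close>

lemma cos_deriv_minus: "cos_deriv n (- u) x = (- 1) ^ n * cos_deriv n u x"
proof (cases "n = 0")
  case False
  have "- (u * x) + real n * (pi / 2) = - (u * x + real n * (pi / 2) - real n * pi)"
    by (simp add: field_simps)
  then have "cos (- (u * x) + real n * (pi / 2)) = cos (u * x + real n * (pi / 2) - real n * pi)"
    by (simp only: cos_minus)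
  also have "\<dots> = (- 1) ^ n * cos (u * x + real n * (pi / 2))"
    unfolding cos_diff[of _ "real n * pi"] cos_npi sin_npi by simp
  finally show ?thesis using False by (simp add: cos_deriv_def)
qed (simp add: cos_deriv_def)

lemma cos_deriv_bound: "2 \<le> n \<Longrightarrow> \<bar>cos_deriv n u x\<bar> \<le> \<bar>x\<bar> ^ n"
  by (simp add: cos_deriv_def abs_mult power_abs mult_left_le)

text \<open>The jump measure need not integrate \<open>\<bar>x\<bar>\<close> near 0. Bounding the
  sine by its argument gains the second factor x at the price of a factor
  \<open>\<bar>u\<bar>\<close>.\<close>

lemma cos_deriv_1_bound: "\<bar>cos_deriv 1 u x\<bar> \<le> \<bar>u\<bar> * x\<^sup>2"
proof -
  have "\<bar>cos_deriv 1 u x\<bar> = \<bar>x\<bar> * \<bar>sin (u * x)\<bar>"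
    by (simp add: cos_deriv_def cos_add abs_mult)
  also have "\<dots> \<le> \<bar>x\<bar> * \<bar>u * x\<bar>"
    by (intro mult_left_mono abs_sin_x_le_abs_x) simp
  finally show ?thesis by (simp add: abs_mult power2_eq_square mult_ac)
qed

text \<open>Orders 0 and 1 are dominated by multiples of \<open>x\<^sup>2\<close>, locally uniformly
  in u, and every order n from 2 on by \<open>\<bar>x\<bar> ^ n\<close>. So moments of order at
  least 2 suffice.\<close>

lemma cos_integral_derivatives:
  fixes \<nu> :: "real measure"
  assumes [measurable_cong]: "sets \<nu> = sets borel"
    and mom: "\<And>n. 2 \<le> n \<Longrightarrow> integrable \<nu> (\<lambda>x. \<bar>x\<bar> ^ n)"
  shows "((\<lambda>u. \<integral>x. cos_deriv n u x \<partial>\<nu>) has_real_derivative (\<integral>x. cos_deriv (Suc n) u x \<partial>\<nu>)) (at u)"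
proof -
  have meas[measurable]: "cos_deriv n u \<in> borel_measurable borel" for n u
    unfolding cos_deriv_def by measurable
  have sq: "integrable \<nu> (\<lambda>x. x\<^sup>2)" using mom[of 2] by simp
  have int: "integrable \<nu> (cos_deriv n u)" for n u
  proof -
    consider "n = 0" | "n = 1" | "2 \<le> n" by linarith
    then show ?thesis
    proof cases
      case 1
      show ?thesis
      proof (rule Bochner_Integration.integrable_bound)
        show "integrable \<nu> (\<lambda>x. u\<^sup>2 * x\<^sup>2)" using sq by simp
        show "AE x in \<nu>. norm (cos_deriv n u x) \<le> norm (u\<^sup>2 * x\<^sup>2)"
          using abs_cos_minus_one_le[of "u * _"] 1 by (auto simp: cos_deriv_def power_mult_distrib)
      qed measurable
    next
      case 2
      show ?thesis
      proof (rule Bochner_Integration.integrable_bound)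
        show "integrable \<nu> (\<lambda>x. \<bar>u\<bar> * x\<^sup>2)" using sq by simp
        show "AE x in \<nu>. norm (cos_deriv n u x) \<le> norm (\<bar>u\<bar> * x\<^sup>2)"
          using cos_deriv_1_bound[of u] 2 by (auto simp: abs_mult)
      qed measurable
    next
      case 3
      show ?thesis
      proof (rule Bochner_Integration.integrable_bound)
        show "AE x in \<nu>. norm (cos_deriv n u x) \<le> norm (\<bar>x\<bar> ^ n)"
          using cos_deriv_bound[OF 3, of u] by (auto simp: power_abs)
      qed (use mom[OF 3] in measurable)
    qed
  qed
  have "\<exists>w. integrable \<nu> w \<and> (\<forall>v x. u - 1 < v \<longrightarrow> v < u + 1 \<longrightarrow> \<bar>cos_deriv (Suc n) v x\<bar> \<le> w x)"
  proof (cases "n = 0")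
    case True
    show ?thesis
    proof (intro exI[of _ "\<lambda>x. (\<bar>u\<bar> + 1) * x\<^sup>2"] conjI allI impI)
      fix v x :: real assume "u - 1 < v" "v < u + 1"
      then have "\<bar>v\<bar> * x\<^sup>2 \<le> (\<bar>u\<bar> + 1) * x\<^sup>2" by (intro mult_right_mono) auto
      then show "\<bar>cos_deriv (Suc n) v x\<bar> \<le> (\<bar>u\<bar> + 1) * x\<^sup>2"
        using cos_deriv_1_bound[of v x] True by simp
    qed (use sq in simp)
  next
    case False
    then have "2 \<le> Suc n" by simp
    then show ?thesis using mom cos_deriv_bound by blast
  qed
  then obtain w where w: "integrable \<nu> w"
    and w_bound: "\<And>v x. u - 1 < v \<Longrightarrow> v < u + 1 \<Longrightarrow> \<bar>cos_deriv (Suc n) v x\<bar> \<le> w x"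
    by blast
  show ?thesis
    by (rule has_real_derivative_integral[of "u - 1" u "u + 1"])
      (auto intro: int w w_bound has_real_derivative_cos_deriv)
qed

section \<open>The exponent as a scaled Laplace transform\<close>

text \<open>A bridge from the gauge integral, used for the power functions below, to the Lebesgue
  integral; nonnegativity makes integrability absolute.\<close>

lemma integrable_on_imp_integrable_lborel:
  assumes "f integrable_on S" "\<And>x. x \<in> S \<Longrightarrow> 0 \<le> f x" "f \<in> borel_measurable borel" "S \<in> sets borel"
  shows "integrable lborel (\<lambda>x. indicator S x * f x :: real)"
proof -
  have "f absolutely_integrable_on S"
    using assms(1,2) by (rule nonnegative_absolutely_integrable_1)
  then have "integrable lebesgue (\<lambda>x. indicator S x * f x)"
    by (simp add: set_integrable_def)
  then show ?thesis
    using assms by (subst (asm) integrable_completion) auto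
qed

text \<open>Near 0 the bound 1 - cos v \<le> v^2 leaves the power 1 - \<alpha>, integrable since
  \<alpha> < 2. Away from 0 the bound 1 - cos v \<le> 2 leaves the power -\<alpha> - 1, integrable
  at infinity since \<alpha> > 0.\<close>

lemma integrable_one_minus_cos_powr:
  assumes "0 < \<alpha>" "\<alpha> < (2::real)"
  shows "integrable lborel (\<lambda>v. (1 - cos v) * \<bar>v\<bar> powr (- \<alpha> - 1))"
proof -
  define g where "g v = indicator {0<..1} v * v powr (1 - \<alpha>) + 2 * (indicator {1..} v * v powr (- \<alpha> - 1))" for v :: real
  have "integrable lborel (\<lambda>v. indicator {0<..1::real} v * v powr (1 - \<alpha>))"
    using assms by (intro integrable_on_imp_integrable_lborel integrable_on_powr_from_0') auto
  moreover have "integrable lborel (\<lambda>v. indicator {1::real..} v * v powr (- \<alpha> - 1))"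
    using assms by (intro integrable_on_imp_integrable_lborel has_integral_integrable[OF has_integral_powr_to_inf]) auto
  ultimately have g: "integrable lborel g"
    unfolding g_def by auto
  have "integrable lborel (\<lambda>v. g (- v))"
    using lborel_integrable_real_affine[OF g, of "- 1" 0] by simp
  then have gg: "integrable lborel (\<lambda>v. g v + g (- v))" using g by auto
  have g0: "0 \<le> g v" for v by (auto simp: g_def)
  have pos: "(1 - cos v) * v powr (- \<alpha> - 1) \<le> g v" if "0 < v" for v
  proof (cases "v \<le> 1")
    case True
    have "(1 - cos v) * v powr (- \<alpha> - 1) \<le> v\<^sup>2 * v powr (- \<alpha> - 1)"
      using abs_cos_minus_one_le[of v] by (intro mult_right_mono) auto
    also have "\<dots> = v powr (1 - \<alpha>)"
      using that by (simp add: powr_add[symmetric] flip: powr_numeral)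
    finally show ?thesis using True that by (auto simp: g_def split: split_indicator)
  next
    case False
    have "(1 - cos v) * v powr (- \<alpha> - 1) \<le> 2 * v powr (- \<alpha> - 1)"
      using cos_ge_minus_one[of v] by (intro mult_right_mono) auto
    then show ?thesis using False that by (auto simp: g_def split: split_indicator)
  qed
  have "(1 - cos v) * \<bar>v\<bar> powr (- \<alpha> - 1) \<le> g v + g (- v)" for v
  proof -
    consider "v = 0" | "0 < v" | "0 < - v" by linarith
    then show ?thesis
      using pos[of v] pos[of "- v"] g0[of v] g0[of "- v"] by cases auto
  qed
  moreover have "0 \<le> (1 - cos v) * \<bar>v\<bar> powr (- \<alpha> - 1)" for v
    by (intro mult_nonneg_nonneg) auto
  ultimately show ?thesis
    using gg by (intro Bochner_Integration.integrable_bound[OF gg] AE_I2) (auto simp: abs_of_nonneg intro: order_trans[OF _ abs_ge_self])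
qed

section \<open>Symmetry, measurability and moments of the jump measure\<close>

lemma distr_uminus_density_even:
  fixes w :: "real \<Rightarrow> ennreal"
  assumes [measurable]: "w \<in> borel_measurable borel" and even: "\<And>s. w (- s) = w s"
  shows "distr (density lborel w) borel uminus = density lborel w"
proof -
  have "distr (density lborel (\<lambda>x. w (- x))) borel uminus = density (distr lborel borel uminus) w"
    by (rule density_distr[symmetric]) auto
  then show ?thesis
    by (simp add: lborel_distr_uminus even)
qed

lemma completely_monotoneD:
  assumes "completely_monotone q" "0 < s"
  shows "q differentiable (at s)" "0 \<le> q s"
proof -
  have "(deriv ^^ 0) q differentiable (at s) \<and> 0 \<le> (- 1) ^ 0 * (deriv ^^ 0) q s"
    using assms unfolding completely_monotone_def by blast
  then show "q differentiable (at s)" "0 \<le> q s" by simp_all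
qed

text \<open>Complete monotonicity gives continuity on the positive half-line only;
  \<open>q 0\<close> is arbitrary, hence the exceptional point.\<close>

lemma completely_monotone_abs_measurable:
  assumes "completely_monotone q"
  shows "(\<lambda>s. q \<bar>s\<bar>) \<in> borel_measurable borel"
proof (rule borel_measurable_continuous_countable_exceptions[of "{0}"])
  have "continuous_on {0<..} q"
    using completely_monotoneD(1)[OF assms]
    by (auto intro!: continuous_at_imp_continuous_on differentiable_imp_continuous_within)
  then show "continuous_on (- {0}) (\<lambda>s. q \<bar>s\<bar>)"
    by (rule continuous_on_compose2) (auto intro!: continuous_intros)
qed simp

text \<open>For jumps of size below 1, n \<ge> 2 gives a bound by \<open>min 1 (x\<^sup>2)\<close>,
  which a Levy measure integrates. For the others the tail condition on q applies, transported to
  the negative half-line by reflection.\<close>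

lemma levy_density_moments:
  fixes q :: "real \<Rightarrow> real"
  assumes \<nu>: "\<nu> = density lborel (\<lambda>s. ennreal (\<bar>s\<bar> powr (- \<alpha> - 1) * q \<bar>s\<bar>))"
    and levy: "levy_measure \<nu>"
    and q[measurable]: "(\<lambda>s. q \<bar>s\<bar>) \<in> borel_measurable borel" and q0: "\<And>s. 0 < s \<Longrightarrow> 0 \<le> q s"
    and tail: "set_integrable lborel {1..} (\<lambda>s. s powr (real n - \<alpha> - 1) * q s)"
    and n: "2 \<le> n"
  shows "integrable \<nu> (\<lambda>x. \<bar>x\<bar> ^ n)"
proof -
  have w0: "0 \<le> \<bar>s\<bar> powr (- \<alpha> - 1) * q \<bar>s\<bar>" for s
    using q0[of "\<bar>s\<bar>"] by (cases "s = 0") auto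
  have [measurable_cong]: "sets \<nu> = sets borel" by (simp add: \<nu>)
  have "(\<integral>\<^sup>+x. ennreal (min 1 (x\<^sup>2)) \<partial>\<nu>) < \<infinity>"
    using levy by (simp add: levy_measure_def)
  then have small: "integrable \<nu> (\<lambda>x. min 1 (x\<^sup>2))"
    by (auto simp: integrable_iff_bounded)
  define h where "h s = indicator {1..} s * (s powr (real n - \<alpha> - 1) * q s)" for s
  have h: "integrable lborel h"
    using tail by (simp add: set_integrable_def h_def[abs_def])
  have "integrable lborel (\<lambda>s. h (- s))"
    using lborel_integrable_real_affine[OF h, of "- 1" 0] by simp
  with h have hh: "integrable lborel (\<lambda>s. h s + h (- s))" by auto
  have pow: "s powr (real n - \<alpha> - 1) = s powr (- \<alpha> - 1) * s ^ n" if "1 \<le> s" for s :: real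
    using that by (simp add: powr_realpow[symmetric] powr_add[symmetric] algebra_simps)
  have "h s + h (- s) = (\<bar>s\<bar> powr (- \<alpha> - 1) * q \<bar>s\<bar>) *\<^sub>R (indicator {x. 1 \<le> \<bar>x\<bar>} s * \<bar>s\<bar> ^ n)" for s
  proof -
    consider "\<bar>s\<bar> < 1" | "1 \<le> s" | "1 \<le> - s" by linarith
    then show ?thesis
      using pow[of s] pow[of "- s"] by cases (auto simp: h_def)
  qed
  with hh have "integrable lborel (\<lambda>s. (\<bar>s\<bar> powr (- \<alpha> - 1) * q \<bar>s\<bar>) *\<^sub>R (indicator {x. 1 \<le> \<bar>x\<bar>} s * \<bar>s\<bar> ^ n))"
    by simp
  then have large: "integrable \<nu> (\<lambda>x. indicator {x. 1 \<le> \<bar>x\<bar>} x * \<bar>x\<bar> ^ n)"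
    unfolding \<nu> using w0 by (subst integrable_density) auto
  show ?thesis
  proof (rule Bochner_Integration.integrable_bound)
    show "integrable \<nu> (\<lambda>x. min 1 (x\<^sup>2) + indicator {x. 1 \<le> \<bar>x\<bar>} x * \<bar>x\<bar> ^ n)"
      using small large by auto
    have "\<bar>x\<bar> ^ n \<le> min 1 (x\<^sup>2) + indicator {x. 1 \<le> \<bar>x\<bar>} x * \<bar>x\<bar> ^ n" for x :: real
    proof (cases "1 \<le> \<bar>x\<bar>")
      case False
      then have "\<bar>x\<bar> ^ n \<le> \<bar>x\<bar>\<^sup>2" "\<bar>x\<bar> ^ n \<le> 1"
        using n power_decreasing[of 2 n "\<bar>x\<bar>"] power_le_one[of "\<bar>x\<bar>" n] by auto
      then show ?thesis by (simp add: indicator_def)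
    qed simp
    then show "AE x in \<nu>. norm (\<bar>x\<bar> ^ n) \<le> norm (min 1 (x\<^sup>2) + indicator {x. 1 \<le> \<bar>x\<bar>} x * \<bar>x\<bar> ^ n)"
      by (intro AE_I2) (auto intro: order_trans[OF _ abs_ge_self])
  qed measurable
qed

lemma AE_False_iff: "(AE x in M. False) \<longleftrightarrow> emeasure M (space M) = 0"
  by (subst AE_iff_measurable[of "space M"]) auto

text \<open>The image of this measure times \<open>F\<close> under \<open>(v, l) \<mapsto> l \<bar>v\<bar>\<close> is the measure \<open>\<rho>\<close> with
  \<open>-\<gamma>(u) = u\<^sup>\<alpha> \<integral> e\<^bsup>-x/u\<^esup> \<rho>(dx)\<close>.\<close>

definition oscillation_measure :: "real \<Rightarrow> real measure" where
  "oscillation_measure \<alpha> = density lborel (\<lambda>v. ennreal ((1 - cos v) * \<bar>v\<bar> powr (- \<alpha> - 1)))"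

lemma sets_oscillation_measure[simp, measurable_cong]: "sets (oscillation_measure \<alpha>) = sets borel"
  by (simp add: oscillation_measure_def)

lemma oscillation_density_nonneg: "0 \<le> (1 - cos v) * \<bar>v\<bar> powr (- \<alpha> - 1)" for v \<alpha> :: real
  by (intro mult_nonneg_nonneg) auto

lemma finite_oscillation_measure:
  assumes "0 < \<alpha>" "\<alpha> < 2"
  shows "finite_measure (oscillation_measure \<alpha>)"
proof
  have "(\<integral>\<^sup>+v. ennreal ((1 - cos v) * \<bar>v\<bar> powr (- \<alpha> - 1)) \<partial>lborel) < \<infinity>"
    using integrable_one_minus_cos_powr[OF assms] oscillation_density_nonneg[of _ \<alpha>]
    by (simp add: integrable_iff_bounded)
  then show "emeasure (oscillation_measure \<alpha>) (space (oscillation_measure \<alpha>)) \<noteq> \<infinity>"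
    by (simp add: oscillation_measure_def emeasure_density)
qed

text \<open>The density is positive on the interval from 0 to 1, where the cosine stays below
  1.\<close>

lemma oscillation_measure_nonzero: "emeasure (oscillation_measure \<alpha>) (space (oscillation_measure \<alpha>)) \<noteq> 0"
proof
  assume "emeasure (oscillation_measure \<alpha>) (space (oscillation_measure \<alpha>)) = 0"
  then have "(\<integral>\<^sup>+v. ennreal ((1 - cos v) * \<bar>v\<bar> powr (- \<alpha> - 1)) \<partial>lborel) = 0"
    by (simp add: oscillation_measure_def emeasure_density)
  then have "AE v in lborel. ennreal ((1 - cos v) * \<bar>v\<bar> powr (- \<alpha> - 1)) = 0"
    by (subst (asm) nn_integral_0_iff_AE) auto
  then have "AE v in lborel. v \<notin> {0<..<1::real}"
  proof eventually_elim
    case (elim v)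
    show ?case
    proof
      assume v: "v \<in> {0<..<1}"
      then have "cos v < cos 0" using pi_gt3 by (intro cos_monotone_0_pi) auto
      with v have "0 < (1 - cos v) * \<bar>v\<bar> powr (- \<alpha> - 1)" by simp
      with elim show False by (simp add: ennreal_eq_0_iff)
    qed
  qed
  then have "emeasure lborel {0<..<1::real} = 0"
    by (subst (asm) AE_iff_measurable[of "{0<..<1}"]) auto
  then show False by simp
qed

text \<open>After the substitution v = u s, the mixture formula turns
  \<open>q \<bar>v / u\<bar>\<close> into an integral of exponentials against F, and Fubini merges
  the two integrals. The total mass is finite and the exponentials are at most 1 because F lives on
  the nonnegative half-line.\<close>

lemma cos_integral_eq_scaled_laplace:
  fixes q :: "real \<Rightarrow> real"
  assumes \<nu>: "\<nu> = density lborel (\<lambda>s. ennreal (\<bar>s\<bar> powr (- \<alpha> - 1) * q \<bar>s\<bar>))"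
    and \<alpha>: "0 < \<alpha>" "\<alpha> < 2"
    and q[measurable]: "(\<lambda>s. q \<bar>s\<bar>) \<in> borel_measurable borel" and q0: "\<And>s. 0 < s \<Longrightarrow> 0 \<le> q s"
    and F: "sets F = sets (restrict_space borel {0..})" "finite_measure F"
    and mix: "\<And>s. 0 < s \<Longrightarrow> has_bochner_integral F (\<lambda>l. exp (- l * s)) (q s)"
    and u: "0 < u"
  shows "(\<integral>s. cos_deriv 0 u s \<partial>\<nu>)
    = - (\<integral>p. scaled_exp_deriv \<alpha> 0 u (snd p * \<bar>fst p\<bar>) \<partial>(oscillation_measure \<alpha> \<Otimes>\<^sub>M F))"
proof -
  let ?O = "oscillation_measure \<alpha>"
  interpret O: finite_measure ?O by (rule finite_oscillation_measure[OF \<alpha>])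
  interpret F: finite_measure F by fact
  interpret pair_sigma_finite ?O F ..
  interpret P: finite_measure "?O \<Otimes>\<^sub>M F"
    by (rule finite_measure_pair_measure) (unfold_locales)
  have spF: "space F = {0..}"
    using sets_eq_imp_space_eq[OF F(1)] by (simp add: space_restrict_space)
  have [measurable]: "(\<lambda>l. l) \<in> borel_measurable F"
    using F(1) by (simp cong: measurable_cong_sets) (rule measurable_restrict_space1, simp)
  have [measurable]: "snd \<in> borel_measurable (?O \<Otimes>\<^sub>M F)"
    using measurable_compose[OF measurable_snd, of "\<lambda>l. l" F borel ?O] by simp
  have w0: "0 \<le> \<bar>s\<bar> powr (- \<alpha> - 1) * q \<bar>s\<bar>" for s
    using q0[of "\<bar>s\<bar>"] by (cases "s = 0") auto
  let ?k = "\<lambda>v. (1 - cos v) * \<bar>v\<bar> powr (- \<alpha> - 1)"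
  \<comment> \<open>The density contributes the power \<alpha> + 1 of u and the substitution the
    factor 1/u. At v = 0, where the mixture formula says nothing, both sides vanish.\<close>
  have eq: "1 / u * (\<bar>v / u\<bar> powr (- \<alpha> - 1) * q \<bar>v / u\<bar> * (cos v - 1))
      = - (u powr \<alpha>) * (?k v * (\<integral>l. exp (- (l * \<bar>v\<bar> / u)) \<partial>F))" for v
  proof (cases "v = 0")
    case False
    have "(\<integral>l. exp (- (l * \<bar>v\<bar> / u)) \<partial>F) = q \<bar>v / u\<bar>"
      using has_bochner_integral_integral_eq[OF mix[of "\<bar>v / u\<bar>"]] u False by (simp add: abs_divide)
    moreover have "\<bar>v / u\<bar> powr (- \<alpha> - 1) = \<bar>v\<bar> powr (- \<alpha> - 1) * (u powr \<alpha> * u)"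
    proof -
      have "u powr (- \<alpha> - 1) = 1 / (u powr \<alpha> * u)"
        using u by (simp add: powr_diff powr_minus field_simps)
      then show ?thesis using u by (simp add: abs_divide powr_divide)
    qed
    ultimately show ?thesis using u by (simp add: algebra_simps)
  qed simp
  have "(\<integral>s. cos_deriv 0 u s \<partial>\<nu>) = (\<integral>s. \<bar>s\<bar> powr (- \<alpha> - 1) * q \<bar>s\<bar> * (cos (u * s) - 1) \<partial>lborel)"
    unfolding \<nu> cos_deriv_def using w0 by (subst integral_density) auto
  also have "\<dots> = (1 / u) * (\<integral>v. \<bar>v / u\<bar> powr (- \<alpha> - 1) * q \<bar>v / u\<bar> * (cos v - 1) \<partial>lborel)"
    using u by (subst lborel_integral_real_affine[of "1 / u" _ 0]) auto
  also have "\<dots> = (\<integral>v. 1 / u * (\<bar>v / u\<bar> powr (- \<alpha> - 1) * q \<bar>v / u\<bar> * (cos v - 1)) \<partial>lborel)"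
    by (rule integral_mult_right_zero[symmetric])
  also have "\<dots> = (\<integral>v. - (u powr \<alpha>) * (?k v * (\<integral>l. exp (- (l * \<bar>v\<bar> / u)) \<partial>F)) \<partial>lborel)"
    unfolding eq ..
  also have "\<dots> = - (u powr \<alpha>) * (\<integral>v. ?k v *\<^sub>R (\<integral>l. exp (- (l * \<bar>v\<bar> / u)) \<partial>F) \<partial>lborel)"
    by simp
  also have "(\<integral>v. ?k v *\<^sub>R (\<integral>l. exp (- (l * \<bar>v\<bar> / u)) \<partial>F) \<partial>lborel) = (\<integral>v. (\<integral>l. exp (- (l * \<bar>v\<bar> / u)) \<partial>F) \<partial>?O)"
    unfolding oscillation_measure_def
  proof (rule integral_density[symmetric])
    show "(\<lambda>v. \<integral>l. exp (- (l * \<bar>v\<bar> / u)) \<partial>F) \<in> borel_measurable lborel"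
      by measurable
  qed (use oscillation_density_nonneg in auto)
  also have "\<dots> = (\<integral>p. exp (- (snd p * \<bar>fst p\<bar> / u)) \<partial>(?O \<Otimes>\<^sub>M F))"
  proof -
    have "integrable (?O \<Otimes>\<^sub>M F) (\<lambda>p. exp (- (snd p * \<bar>fst p\<bar> / u)))"
    proof (rule P.integrable_const_bound[where B = 1])
      show "AE p in ?O \<Otimes>\<^sub>M F. norm (exp (- (snd p * \<bar>fst p\<bar> / u))) \<le> 1"
        using u spF by (intro AE_I2) (simp add: space_pair_measure mem_Times_iff)
    qed measurable
    from integral_fst'[OF this] show ?thesis by simp
  qed
  finally show ?thesis
    by (simp add: scaled_exp_deriv_def)
qed

section \<open>Identification of the exponent and assembly of the estimates\<close>

lemma exp_scaleR_inj:
  fixes z w :: complex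
  assumes "\<And>t::real. 0 \<le> t \<Longrightarrow> exp (of_real t * z) = exp (of_real t * w)"
  shows "z = w"
proof -
  have e: "exp (of_real t * (z - w)) = 1" if "0 \<le> t" for t :: real
    using assms[OF that] by (simp add: right_diff_distrib exp_diff)
  have "Re (z - w) = 0"
    using e[of 1] by (simp add: exp_eq_1)
  moreover have "Im (z - w) = 0"
  proof (rule ccontr)
    \<comment> \<open>One value of t fixes the imaginary part only modulo 2 pi. The time chosen here
      rotates the difference to plus or minus pi, where the exponential is -1 instead of 1.\<close>
    assume *: "Im (z - w) \<noteq> 0"
    then have "pi / \<bar>Im (z - w)\<bar> * Im (z - w) = pi \<or> pi / \<bar>Im (z - w)\<bar> * Im (z - w) = - pi"
      by (simp only: abs_if) (auto simp del: minus_complex.sel)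
    then have "cos (pi / \<bar>Im (z - w)\<bar> * Im (z - w)) = - 1"
      by (metis cos_minus cos_pi)
    moreover have "Re (exp (of_real (pi / \<bar>Im (z - w)\<bar>) * (z - w))) = cos (pi / \<bar>Im (z - w)\<bar> * Im (z - w))"
      using \<open>Re (z - w) = 0\<close> by (simp add: Re_exp)
    ultimately show False using e[of "pi / \<bar>Im (z - w)\<bar>"] by simp
  qed
  ultimately show ?thesis by (simp add: complex_eq_iff)
qed

lemma nth_vector_derivative_of_real:
  assumes "\<And>n u. (D n has_real_derivative D (Suc n) u) (at u)"
  shows "nth_vector_derivative n (\<lambda>u. complex_of_real (D 0 u)) = (\<lambda>u. of_real (D n u))"
    and "times_differentiable n (\<lambda>u. complex_of_real (D 0 u))"
proof -
  have d: "((\<lambda>u. complex_of_real (D n u)) has_vector_derivative of_real (D (Suc n) u)) (at u)" for n u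
    using assms by (intro bounded_linear.has_vector_derivative[OF bounded_linear_of_real])
      (simp add: has_real_derivative_iff_has_vector_derivative)
  have n: "nth_vector_derivative n (\<lambda>u. complex_of_real (D 0 u)) = (\<lambda>u. of_real (D n u))" for n
    by (induction n) (auto simp: nth_vector_derivative_def intro!: vector_derivative_at d)
  show "nth_vector_derivative n (\<lambda>u. complex_of_real (D 0 u)) = (\<lambda>u. of_real (D n u))" by (rule n)
  show "times_differentiable n (\<lambda>u. complex_of_real (D 0 u))"
    unfolding times_differentiable_def n using d by (blast intro: differentiableI_vector)
qed

theorem proposition7p5:
  fixes M :: "'a measure" and X :: "real \<Rightarrow> 'a \<Rightarrow> real" and \<nu> F :: "real measure"
    and \<alpha> :: real and q :: "real \<Rightarrow> real" and \<gamma> :: "real \<Rightarrow> complex"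
  assumes "prob_space M"
    and "prob_space.levy_process M X"
    and "prob_space.has_levy_triplet M X 0 0 \<nu>"
    and "0 < \<alpha>" and "\<alpha> < 2"
    and "\<nu> = density lborel (\<lambda>s. ennreal (\<bar>s\<bar> powr (- \<alpha> - 1) * q \<bar>s\<bar>))"
    and "completely_monotone q"
    and "\<exists>s>0. q s \<noteq> 0"
    and "\<And>j::nat. 1 \<le> j \<Longrightarrow> set_integrable lborel {1..} (\<lambda>s. s powr (real j - \<alpha> - 1) * q s)"
    and "sets F = sets (restrict_space borel {0..})"
    and "\<And>s. 0 < s \<Longrightarrow> has_bochner_integral F (\<lambda>l. exp (- l * s)) (q s)"
    and "\<And>j::nat. integrable F (\<lambda>l. l ^ j)"
    and "prob_space.characteristic_exponent M X \<gamma>"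
  shows "(\<forall>i::nat. 1 \<le> i \<longrightarrow> times_differentiable i \<gamma> \<and>
            (\<exists>c u0. 0 < u0 \<and>
               (\<forall>u. u0 < \<bar>u\<bar> \<longrightarrow>
                  norm (nth_vector_derivative i \<gamma> u) \<le> c * \<bar>u\<bar> powr (\<alpha> - real i)))) \<and>
         (\<exists>u0 c0. 0 < u0 \<and> 0 < c0 \<and>
            (\<forall>u>u0. norm (char (distr M borel (X 1)) u) \<le> exp (- c0 * \<bar>u\<bar> powr \<alpha>)))"
proof -
  note \<alpha> = assms(4,5) and \<nu> = assms(6) and mix = assms(11)
  interpret prob_space M by fact
  note q_meas[measurable] = completely_monotone_abs_measurable[OF assms(7)]
  note q0 = completely_monotoneD(2)[OF assms(7)]
  have levy: "levy_measure \<nu>"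
    using assms(3) by (simp add: has_levy_triplet_def)
  have \<nu>_sets: "sets \<nu> = sets borel" by (simp add: \<nu>)
  have mom: "integrable \<nu> (\<lambda>x. \<bar>x\<bar> ^ n)" if "2 \<le> n" for n
    using that by (intro levy_density_moments[OF \<nu> levy q_meas q0 assms(9)]) auto
  define D where "D n u = (\<integral>x. cos_deriv n u x \<partial>\<nu>)" for n u
  have D0: "D 0 u = (\<integral>x. cos (u * x) - 1 \<partial>\<nu>)" for u
    by (simp add: D_def cos_deriv_def)
  have char_X: "char (distr M borel (X t)) u = exp (of_real (t * D 0 u))" if "0 \<le> t" for t u
    unfolding D0
  proof (rule symmetric_pure_jump_char[OF assms(3) _ that])
    show "random_variable borel (X t)"
      using assms(2) that by (simp add: levy_process_def)
    show "sigma_finite_measure \<nu>"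
      unfolding \<nu> by (subst sigma_finite_measure.sigma_finite_iff_density_finite[OF lborel.sigma_finite_measure_axioms]) auto
    show "distr \<nu> borel uminus = \<nu>"
      unfolding \<nu> by (rule distr_uminus_density_even) auto
    show "integrable \<nu> (\<lambda>x. x\<^sup>2)"
      using mom[of 2] by simp
  qed
  \<comment> \<open>The characteristic functions agree at all times t \<ge> 0, which determines the
    exponent pointwise; in particular it is real.\<close>
  have \<gamma>: "\<gamma> = (\<lambda>u. of_real (D 0 u))"
  proof
    fix u
    show "\<gamma> u = of_real (D 0 u)"
    proof (rule exp_scaleR_inj)
      fix t :: real assume t: "0 \<le> t"
      with assms(13) have "exp (of_real t * \<gamma> u) = char (distr M borel (X t)) u"
        unfolding characteristic_exponent_def by metis
      then show "exp (of_real t * \<gamma> u) = exp (of_real t * of_real (D 0 u))"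
        using char_X[OF t, of u] by simp
    qed
  qed
  have D_deriv: "(D n has_real_derivative D (Suc n) u) (at u)" for n u
    unfolding D_def by (rule cos_integral_derivatives[OF \<nu>_sets mom])
  have D_minus: "D n (- u) = (- 1) ^ n * D n u" for n u
    unfolding D_def cos_deriv_minus by simp

  let ?P = "oscillation_measure \<alpha> \<Otimes>\<^sub>M F"
  define Z :: "real \<times> real \<Rightarrow> real" where "Z p = snd p * \<bar>fst p\<bar>" for p
  \<comment> \<open>The moment of order 0 is the total mass.\<close>
  have finF: "finite_measure F"
    using assms(12)[of 0] by (intro finite_measureI) (simp add: integrable_iff_bounded)
  interpret O: finite_measure "oscillation_measure \<alpha>" by (rule finite_oscillation_measure[OF \<alpha>])
  interpret F: finite_measure F by fact
  interpret P: finite_measure ?P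
    by (rule finite_measure_pair_measure) (unfold_locales)
  have "(\<lambda>l. l) \<in> borel_measurable F"
    using assms(10) by (simp cong: measurable_cong_sets) (rule measurable_restrict_space1, simp)
  then have [measurable]: "snd \<in> borel_measurable ?P"
    using measurable_compose[OF measurable_snd, of "\<lambda>l. l" F borel "oscillation_measure \<alpha>"] by simp
  have Z[measurable]: "Z \<in> borel_measurable ?P"
    unfolding Z_def by measurable
  have spF: "space F = {0..}"
    using sets_eq_imp_space_eq[OF assms(10)] by (simp add: space_restrict_space)
  have Z0: "0 \<le> Z p" if "p \<in> space ?P" for p
    using that spF by (simp add: Z_def space_pair_measure mem_Times_iff)
  define G where "G n u = (\<integral>p. scaled_exp_deriv \<alpha> n u (Z p) \<partial>?P)" for n u
  have G_deriv: "(G n has_real_derivative G (Suc n) u) (at u)" if "0 < u" for n u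
    unfolding G_def by (rule P.scaled_laplace_has_derivative[OF Z _ that]) (rule Z0)
  have G_bound: "\<exists>C. \<forall>u>0. \<bar>G n u\<bar> \<le> C * u powr (\<alpha> - real n)" for n
    unfolding G_def by (rule P.scaled_laplace_bound[OF Z]) (rule Z0)
  \<comment> \<open>\<open>D 0\<close> and \<open>- G 0\<close> agree on the open half-line, so
    their successive derivatives agree there as well. Smoothness on the whole line comes from D, the
    size of the derivatives from G.\<close>
  have DG: "D n u = - G n u" if "0 < u" for n u
    using that
  proof (induction n arbitrary: u)
    case 0
    then show ?case
      unfolding D_def G_def Z_def
      by (intro cos_integral_eq_scaled_laplace[OF \<nu> \<alpha> q_meas q0 assms(10) finF mix])
  next
    case (Suc n)
    have "(D n has_real_derivative - G (Suc n) u) (at u)"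
      by (rule has_field_derivative_transform_within_open[OF DERIV_minus[OF G_deriv[OF Suc.prems]], of "{0<..}"])
        (use Suc in auto)
    with D_deriv show ?case by (rule DERIV_unique)
  qed

  have smooth: "times_differentiable i \<gamma> \<and> (\<exists>c u0. 0 < u0 \<and> (\<forall>u. u0 < \<bar>u\<bar> \<longrightarrow>
      norm (nth_vector_derivative i \<gamma> u) \<le> c * \<bar>u\<bar> powr (\<alpha> - real i)))" for i
  proof -
    obtain C where C: "\<And>u. 0 < u \<Longrightarrow> \<bar>G i u\<bar> \<le> C * u powr (\<alpha> - real i)"
      using G_bound by blast
    \<comment> \<open>Parity of \<open>D i\<close> reduces the claim to positive arguments. The
      bound on \<open>G i\<close> holds for all of these, so 1 is merely a convenient
      threshold.\<close>
    have "\<bar>D i u\<bar> \<le> C * \<bar>u\<bar> powr (\<alpha> - real i)" if "1 < \<bar>u\<bar>" for u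
    proof -
      have "\<bar>D i u\<bar> = \<bar>D i \<bar>u\<bar>\<bar>"
        using D_minus[of i u] by (cases "0 \<le> u") (auto simp: abs_mult power_abs)
      also have "\<dots> \<le> C * \<bar>u\<bar> powr (\<alpha> - real i)"
        using C[of "\<bar>u\<bar>"] DG[of "\<bar>u\<bar>" i] that by simp
      finally show ?thesis .
    qed
    then have "\<forall>u. 1 < \<bar>u\<bar> \<longrightarrow> norm (nth_vector_derivative i \<gamma> u) \<le> C * \<bar>u\<bar> powr (\<alpha> - real i)"
      unfolding \<gamma> nth_vector_derivative_of_real(1)[of D, OF D_deriv] by simp
    moreover have "times_differentiable i \<gamma>"
      unfolding \<gamma> by (rule nth_vector_derivative_of_real(2)[of D, OF D_deriv])
    ultimately show ?thesis
      using zero_less_one by blast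
  qed
  have decay: "\<exists>u0 c0. 0 < u0 \<and> 0 < c0 \<and>
      (\<forall>u>u0. norm (char (distr M borel (X 1)) u) \<le> exp (- c0 * \<bar>u\<bar> powr \<alpha>))"
  proof -
    have int: "integrable ?P (\<lambda>p. exp (- (Z p / u)))" if "0 < u" for u
      using that Z0 by (intro P.integrable_const_bound[where B = 1] AE_I2) auto
    \<comment> \<open>This is \<open>G 0 1\<close>, the integral of e^(-x) against the measure
      \<rho> of the overview.\<close>
    define c0 where "c0 = (\<integral>p. exp (- Z p) \<partial>?P)"
    have int1: "integrable ?P (\<lambda>p. exp (- Z p))" using int[of 1] by simp
    \<comment> \<open>Otherwise the product measure would be zero. As the oscillation measure is
      not, F would be zero, and the mixture formula would make q vanish on the positive
      half-line.\<close>
    have "c0 \<noteq> 0"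
    proof
      assume "c0 = 0"
      then have "AE p in ?P. exp (- Z p) = 0"
        unfolding c0_def using integral_nonneg_eq_0_iff_AE[OF int1] by simp
      then have "emeasure ?P (space ?P) = 0"
        by (simp add: AE_False_iff)
      then have "emeasure (oscillation_measure \<alpha>) (space (oscillation_measure \<alpha>)) * emeasure F (space F) = 0"
        unfolding space_pair_measure
        by (simp only: F.emeasure_pair_measure_Times[OF sets.top sets.top])
      then have "emeasure F (space F) = 0"
        using oscillation_measure_nonzero[of \<alpha>] by (simp only: mult_eq_0_iff simp_thms)
      then have F0: "AE l in F. False"
        by (simp add: AE_False_iff)
      obtain s where s: "0 < s" "q s \<noteq> 0" using assms(8) by blast
      have "q s = (\<integral>l. exp (- l * s) \<partial>F)"
        using has_bochner_integral_integral_eq[OF mix[OF s(1)]] by simp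
      also have "\<dots> = 0"
        using F0 by (intro integral_eq_zero_AE) auto
      finally show False using s by simp
    qed
    moreover have "0 \<le> c0" unfolding c0_def by simp
    ultimately have c0: "0 < c0" by simp
    have "norm (char (distr M borel (X 1)) u) \<le> exp (- c0 * \<bar>u\<bar> powr \<alpha>)" if u: "1 < u" for u
    proof -
      \<comment> \<open>Here the threshold u > 1 enters: dividing the nonnegative \<open>Z p\<close>
        by u can only increase the exponential.\<close>
      have "c0 \<le> (\<integral>p. exp (- (Z p / u)) \<partial>?P)"
        unfolding c0_def
      proof (rule integral_mono[OF int1 int])
        fix p assume "p \<in> space ?P"
        then have "Z p / u \<le> Z p / 1" using Z0 u by (intro divide_left_mono) auto
        then show "exp (- Z p) \<le> exp (- (Z p / u))" by simp
      qed (use u in simp)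
      then have "u powr \<alpha> * c0 \<le> G 0 u"
        unfolding G_def by (simp add: scaled_exp_deriv_def mult_left_mono)
      \<comment> \<open>The exponent is real, so the modulus of the characteristic function is the
        exponential itself.\<close>
      moreover have "norm (char (distr M borel (X 1)) u) = exp (- G 0 u)"
        using char_X[of 1 u] DG[of u 0] u by simp
      ultimately show ?thesis
        using u by (simp add: mult.commute)
    qed
    with c0 show ?thesis using zero_less_one by blast
  qed
  show ?thesis
    by (intro conjI allI impI, rule smooth[THEN conjunct1], rule smooth[THEN conjunct2], rule decay)
qed

end
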